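(* Let $F$ be a field and let $q,n,e\in\mathbb{N}$ with $q>1$ and $e\mid q^n-1$, and put $m=m(q,e)$. If $e\mid\frac{q^d-1}{q-1}$ for some $d\in\{2,3,4\}$, then $$\mathrm{LL}(A(q,n,e))=\left\lfloor n\frac{q-1}{m}\right\rfloor+1.$$
   Context: $\mathbb{N}$ denotes the set of positive integers, $\mathbb{N}_0=\mathbb{N}\cup\{0\}$. For $q,e\in\mathbb{N}$ with $\gcd(q,e)=1$, $m(q,e)$ is the smallest positive integer $t$ such that there exist $i_1,\dots,i_t\in\mathbb{N}_0$ (repetitions allowed) with $e\mid q^{i_1}+\dots+q^{i_t}$. For a field $F$ and $q,n,e\in\mathbb{N}$ with $q>1$ and $e\mid q^n-1$, let $I=(X_1^q,\dots,X_n^q)$ in the polynomial algebra $F[X_1,\dots,X_n]$ and $x_j=X_j+I$. Then $A(q,n,e)$ is the unital $F$-subalgebra of $F[x_1,\dots,x_n]=F[X_1,\dots,X_n]/I$ generated by all monomials $x_1^{i_1}\cdots x_n^{i_n}$ with $i_1+qi_2+\dots+q^{n-1}i_n\equiv 0\pmod e$. For a finite-dimensional algebra $A$ with Jacobson radical $\mathrm{J}(A)$, the Loewy length $\mathrm{LL}(A)$ is the smallest $l\in\mathbb{N}_0$ with $\mathrm{J}(A)^l=0$. *)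

theory Defs
  imports
    Complex_Main
    "HOL-Library.Poly_Mapping"
    "HOL-Number_Theory.Cong"
    "HOL-Algebra.Algebra"
begin

definition min_power_sum :: "nat \<Rightarrow> nat \<Rightarrow> nat" where
  "min_power_sum q e = (LEAST t. 0 < t \<and> (\<exists>i :: nat \<Rightarrow> nat. e dvd (\<Sum>k = 1..t. q ^ i k)))"

text \<open>
  Polynomials over \<open>'a\<close> are finitely supported maps from monomials to coefficients, where a
  monomial is a finitely supported map from variable indices to exponents.
\<close>

type_synonym 'a mpoly = "(nat \<Rightarrow>\<^sub>0 nat) \<Rightarrow>\<^sub>0 'a"

definition mpoly_const :: "'a::field \<Rightarrow> 'a mpoly" where
  "mpoly_const c = Poly_Mapping.single 0 c"

definition mpoly_var :: "nat \<Rightarrow> 'a::field mpoly" where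
  "mpoly_var j = Poly_Mapping.single (Poly_Mapping.single j 1) 1"

definition mpoly_ring :: "nat \<Rightarrow> ('a::field mpoly) ring" where
  "mpoly_ring n =
    \<lparr>carrier = {p. \<forall>t \<in> Poly_Mapping.keys p. Poly_Mapping.keys t \<subseteq> {1..n}},
     monoid.mult = (*), one = 1, ring.zero = 0, ring.add = (+)\<rparr>"

lemma mpoly_ring_cring: "cring (mpoly_ring n :: ('a::field mpoly) ring)"
proof (rule cringI)
  show "abelian_group (mpoly_ring n :: 'a mpoly ring)"
  proof (rule abelian_groupI)
    fix x y :: "'a mpoly"
    assume "x \<in> carrier (mpoly_ring n)" "y \<in> carrier (mpoly_ring n)"
    then show "x \<oplus>\<^bsub>mpoly_ring n\<^esub> y \<in> carrier (mpoly_ring n)"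
      using Poly_Mapping.keys_add[of x y] by (auto simp: mpoly_ring_def)
  next
    fix x :: "'a mpoly"
    assume "x \<in> carrier (mpoly_ring n)"
    then show "\<exists>y \<in> carrier (mpoly_ring n). y \<oplus>\<^bsub>mpoly_ring n\<^esub> x = \<zero>\<^bsub>mpoly_ring n\<^esub>"
      by (intro bexI[of _ "- x"]) (auto simp: mpoly_ring_def)
  qed (auto simp: mpoly_ring_def add.assoc add.commute)
next
  show "Group.comm_monoid (mpoly_ring n :: 'a mpoly ring)"
  proof (rule comm_monoidI)
    fix x y :: "'a mpoly"
    assume xy: "x \<in> carrier (mpoly_ring n)" "y \<in> carrier (mpoly_ring n)"
    have "Poly_Mapping.keys t \<subseteq> {1..n}" if t: "t \<in> Poly_Mapping.keys (x * y)" for t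
    proof -
      obtain a b where ab: "t = a + b" "a \<in> Poly_Mapping.keys x" "b \<in> Poly_Mapping.keys y"
        using t Poly_Mapping.keys_mult[of x y] by blast
      then have "Poly_Mapping.keys t \<subseteq> Poly_Mapping.keys a \<union> Poly_Mapping.keys b"
        using Poly_Mapping.keys_add[of a b] by simp
      with ab xy show ?thesis by (force simp: mpoly_ring_def)
    qed
    then show "x \<otimes>\<^bsub>mpoly_ring n\<^esub> y \<in> carrier (mpoly_ring n)"
      by (simp add: mpoly_ring_def)
  qed (auto simp: mpoly_ring_def mult.assoc mult.commute)
qed (auto simp: mpoly_ring_def algebra_simps)

definition truncated_ring :: "nat \<Rightarrow> nat \<Rightarrow> ('a::field mpoly) set ring" where
  "truncated_ring q n =
    mpoly_ring n Quot (Idl\<^bsub>mpoly_ring n\<^esub> ((\<lambda>j. mpoly_var j ^ q) ` {1..n}))"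

definition truncated_class :: "nat \<Rightarrow> nat \<Rightarrow> 'a::field mpoly \<Rightarrow> 'a mpoly set" where
  "truncated_class q n p =
    (Idl\<^bsub>mpoly_ring n\<^esub> ((\<lambda>j. mpoly_var j ^ q) ` {1..n})) +>\<^bsub>mpoly_ring n\<^esub> p"

text \<open>
  The HOL-Algebra locale \<^locale>\<open>subalgebra\<close> only demands an additive subgroup closed under
  multiplication by \<open>K\<close>; closure under products and the unit come from \<^locale>\<open>subring\<close>.
\<close>

definition generated_subalgebra :: "('b, 'c) ring_scheme \<Rightarrow> 'b set \<Rightarrow> 'b set \<Rightarrow> 'b set" where
  "generated_subalgebra R K S = \<Inter>{V. subring V R \<and> subalgebra K V R \<and> S \<subseteq> V}"

definition A_monomials :: "nat \<Rightarrow> nat \<Rightarrow> nat \<Rightarrow> ('a::field mpoly) set set" where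
  "A_monomials q n e =
    {\<Otimes>\<^bsub>truncated_ring q n\<^esub> j \<in> {1..n}. truncated_class q n (mpoly_var j) [^]\<^bsub>truncated_ring q n\<^esub> i j
      | i :: nat \<Rightarrow> nat. [(\<Sum>j = 1..n. q ^ (j - 1) * i j) = 0] (mod e)}"

definition A_algebra :: "nat \<Rightarrow> nat \<Rightarrow> nat \<Rightarrow> ('a::field mpoly) set ring" where
  "A_algebra q n e = (truncated_ring q n)
    \<lparr>carrier := generated_subalgebra (truncated_ring q n)
       (range (\<lambda>c. truncated_class q n (mpoly_const c))) (A_monomials q n e)\<rparr>"

text \<open>
  For commutative rings only: there, maximal two-sided ideals are the maximal left ideals. The
  intersection with the carrier makes the empty intersection (zero ring) come out right.
\<close>

definition jacobson_radical :: "('b, 'c) ring_scheme \<Rightarrow> 'b set" where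
  "jacobson_radical R = carrier R \<inter> \<Inter>{M. maximalideal M R}"

text \<open>
  Powers are taken in the multiplicative monoid of ideals; in particular the zeroth power of an
  ideal is \<^term>\<open>carrier R\<close>.
\<close>

definition loewy_length :: "('b, 'c) ring_scheme \<Rightarrow> nat" where
  "loewy_length R = (LEAST l :: nat. jacobson_radical R [^]\<^bsub>ideals_set R\<^esub> l = {\<zero>\<^bsub>R\<^esub>})"

end

theory Submission
  imports Defs "HOL-Number_Theory.Number_Theory"
begin

text \<open>
  The admissible monomials (\<open>e\<close> divides \<open>i\<^sub>1 + q i\<^sub>2 + \<dots> + q\<^sup>n\<^sup>-\<^sup>1 i\<^sub>n\<close>) with exponents below \<open>q\<close> form a basis
  of the algebra, and the nonconstant ones span the radical \<open>J\<close>: they are nilpotent, and the quotient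
  is the ground field. Hence \<open>J\<^sup>l \<noteq> 0\<close> iff some product
  of \<open>l\<close> nonconstant admissible monomials has all its exponents below \<open>q\<close>. An admissible nonconstant
  monomial has degree at least \<open>m\<close> by the very definition of \<open>m\<close>, so \<open>l m \<le> n (q - 1)\<close>.

  Conversely, elementary congruences show that \<open>q \<equiv> 1\<close> (mod \<open>e\<close>), or \<open>m\<close> divides \<open>n\<close> and \<open>e\<close> divides
  \<open>1 + q + \<dots> + q\<^sup>m\<^sup>-\<^sup>1\<close>, or one of two exceptional cases with \<open>m \<in> {2, 4}\<close> holds. If \<open>q \<equiv> 1\<close>, divisibility of the value only depends on the degree and the
  \<open>n (q - 1)\<close> available factors are cut greedily into pieces of length \<open>m = e\<close>. In the other cases
  the positions \<open>1, \<dots>, n\<close> split into disjoint blocks carrying an admissible monomial of degree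
  \<open>m\<close>, each of which can be repeated until it is used up.
\<close>

section \<open>Shortest vanishing sums of powers\<close>

text \<open>Taking \<open>e\<close> copies of q^0 = 1 gives a vanishing sum, so the minimum is
  attained.\<close>

lemma min_power_sum_witness:
  assumes "e \<ge> 1"
  shows "0 < min_power_sum q e \<and> (\<exists>i :: nat \<Rightarrow> nat. e dvd (\<Sum>k = 1..min_power_sum q e. q ^ i k))"
  unfolding min_power_sum_def
proof (rule LeastI)
  show "0 < e \<and> (\<exists>i :: nat \<Rightarrow> nat. e dvd (\<Sum>k = 1..e. q ^ i k))"
    using assms by (auto intro!: exI[of _ "\<lambda>_. 0"])
qed

lemma min_power_sum_pos: "e \<ge> 1 \<Longrightarrow> 0 < min_power_sum q e"
  using min_power_sum_witness by blast

text \<open>Minimality in list form: lists carry repetitions without an indexing by 1..t, so later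
  relations can simply be listed.\<close>

lemma min_power_sum_le_length:
  assumes "xs \<noteq> []" and "e dvd sum_list (map ((^) q) xs)"
  shows "min_power_sum q e \<le> length xs"
proof -
  have "sum_list (map ((^) q) xs) = (\<Sum>k = 0..<length xs. q ^ (xs ! k))"
    by (simp add: sum_list_sum_nth)
  also have "\<dots> = (\<Sum>k = 1..length xs. q ^ (xs ! (k - 1)))"
    by (rule sum.reindex_bij_witness[of _ "\<lambda>k. k - 1" Suc]) auto
  finally have "e dvd (\<Sum>k = 1..length xs. q ^ (\<lambda>k. xs ! (k - 1)) k)"
    using assms(2) by simp
  then have "0 < length xs \<and> (\<exists>i :: nat \<Rightarrow> nat. e dvd (\<Sum>k = 1..length xs. q ^ i k))"
    using assms(1) by (intro conjI exI[of _ "\<lambda>k. xs ! (k - 1)"]) auto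
  then show ?thesis
    unfolding min_power_sum_def by (rule Least_le)
qed

lemma sum_list_powers_concat:
  "sum_list (map ((^) (q::nat)) (concat (map (\<lambda>j. replicate (c j) (g j)) js)))
    = sum_list (map (\<lambda>j. q ^ g j * c j) js)"
  by (induction js) (auto simp: sum_list_replicate)

text \<open>The digit vector \<open>c\<close> is read as a list of exponents in which j - 1 occurs
  \<open>c j\<close> times. A positive digit makes this list nonempty.\<close>

lemma min_power_sum_le_sum:
  assumes "e dvd (\<Sum>j = 1..n. q ^ (j - 1) * c j)" and "j \<in> {1..n}" and "c j > 0"
  shows "min_power_sum q e \<le> (\<Sum>j = 1..n. c j)"
proof -
  define xs where "xs = concat (map (\<lambda>j. replicate (c j) (j - 1)) [1..<Suc n])"
  have "xs \<noteq> []"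
    using assms(2,3) by (auto simp: xs_def simp del: upt_Suc intro!: bexI[of _ j])
  moreover have "sum_list (map ((^) q) xs) = (\<Sum>j = 1..n. q ^ (j - 1) * c j)"
    unfolding xs_def sum_list_powers_concat
    by (simp add: interv_sum_list_conv_sum_set_nat atLeastLessThanSuc_atLeastAtMost del: upt_Suc)
  moreover have "length xs = (\<Sum>j = 1..n. c j)"
    unfolding xs_def length_concat
    by (simp add: interv_sum_list_conv_sum_set_nat atLeastLessThanSuc_atLeastAtMost comp_def del: upt_Suc)
  ultimately show ?thesis
    using min_power_sum_le_length[of xs e q] assms(1) by simp
qed

text \<open>A single term means that \<open>e\<close> divides a power of \<open>q\<close>, to which
  it is coprime.\<close>

lemma min_power_sum_eq_1:
  assumes "coprime q e" "e \<ge> 1" "min_power_sum q e = 1"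
  shows "e = 1"
proof -
  obtain i :: "nat \<Rightarrow> nat" where "e dvd q ^ i 1"
    using min_power_sum_witness[OF assms(2), of q] assms(3) by auto
  with assms(1) show ?thesis
    using coprime_common_divisor_nat[of "q ^ i 1" e e] by simp
qed

lemma power_cong_1: "[x ^ k = 1] (mod m)" if "[x = 1] (mod m)" for x m :: nat
  using cong_pow[OF that, of k] by simp

text \<open>Every power of \<open>q\<close> is 1 modulo \<open>e\<close>, so a sum of powers is
  congruent to its number of terms.\<close>

lemma min_power_sum_dvd_pred:
  assumes "e \<ge> 1" "q > 1" "e dvd q - 1"
  shows "min_power_sum q e = e"
proof (rule antisym)
  show "min_power_sum q e \<le> e"
    using min_power_sum_le_length[of "replicate e 0" e q] assms(1) by (simp add: sum_list_replicate)
next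
  obtain i :: "nat \<Rightarrow> nat" where i: "e dvd (\<Sum>k = 1..min_power_sum q e. q ^ i k)"
    using min_power_sum_witness[OF assms(1)] by blast
  have q1: "[q = 1] (mod e)"
    using assms(2,3) by (simp add: cong_altdef_nat)
  have "[(\<Sum>k = 1..min_power_sum q e. q ^ i k) = (\<Sum>k = 1..min_power_sum q e. 1)] (mod e)"
    by (intro cong_sum power_cong_1 q1)
  with i have "e dvd min_power_sum q e"
    by (simp add: cong_dvd_iff)
  then show "e \<le> min_power_sum q e"
    using min_power_sum_pos[OF assms(1)] by (rule dvd_imp_le)
qed

lemma power_mod_exponent_cong:
  assumes "[q ^ d = 1] (mod e)"
  shows "[q ^ i = q ^ (i mod d)] (mod (e::nat))"
proof -
  have "[(q ^ d) ^ (i div d) * q ^ (i mod d) = 1 * q ^ (i mod d)] (mod e)"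
    by (intro cong_mult power_cong_1 assms cong_refl)
  moreover have "(q ^ d) ^ (i div d) * q ^ (i mod d) = q ^ i"
    by (simp flip: power_mult power_add)
  ultimately show ?thesis by simp
qed

text \<open>Exponents may be reduced modulo \<open>d\<close>; the smaller power is then factored out
  and cancelled, being coprime to \<open>e\<close>.\<close>

lemma min_power_sum_eq_2:
  assumes "e \<ge> 1" "coprime q e" "[q ^ d = 1] (mod e)" "d > 0" "min_power_sum q e = 2"
  obtains r where "r < d" "e dvd 1 + q ^ r"
proof -
  note result = that
  obtain i :: "nat \<Rightarrow> nat" where i: "e dvd (\<Sum>k = 1..2. q ^ i k)"
    using min_power_sum_witness[OF assms(1), of q, unfolded assms(5)] by blast
  have "[q ^ i 1 + q ^ i 2 = q ^ (i 1 mod d) + q ^ (i 2 mod d)] (mod e)"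
    by (intro cong_add power_mod_exponent_cong assms(3))
  moreover have "e dvd q ^ i 1 + q ^ i 2"
    using i by (simp add: numeral_2_eq_2)
  ultimately have "e dvd q ^ (i 1 mod d) + q ^ (i 2 mod d)"
    by (simp add: cong_dvd_iff)
  moreover have ?thesis if ab: "a \<le> b" "b < d" and dvd: "e dvd q ^ a + q ^ b" for a b
  proof -
    have "q ^ a + q ^ b = q ^ a * (1 + q ^ (b - a))"
      using ab(1) by (simp add: algebra_simps flip: power_add)
    moreover have "coprime e (q ^ a)"
      using assms(2) by (simp add: coprime_commute)
    ultimately have "e dvd 1 + q ^ (b - a)"
      using dvd coprime_dvd_mult_right_iff by metis
    then show ?thesis
      using result[of "b - a"] ab(2) by linarith
  qed
  ultimately show ?thesis
    using assms(4) linear[of "i 1 mod d" "i 2 mod d"] by (metis add.commute mod_less_divisor)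
qed

text \<open>As for two terms: reduce the exponents modulo \<open>d\<close>, sort them, and cancel
  the smallest power.\<close>

lemma min_power_sum_eq_3:
  assumes "e \<ge> 1" "coprime q e" "[q ^ d = 1] (mod e)" "d > 0" "min_power_sum q e = 3"
  obtains r s where "r \<le> s" "s < d" "e dvd 1 + q ^ r + q ^ s"
proof -
  note result = that
  obtain i :: "nat \<Rightarrow> nat" where i: "e dvd (\<Sum>k = 1..3. q ^ i k)"
    using min_power_sum_witness[OF assms(1), of q, unfolded assms(5)] by blast
  have "[q ^ i 1 + q ^ i 2 + q ^ i 3 = q ^ (i 1 mod d) + q ^ (i 2 mod d) + q ^ (i 3 mod d)] (mod e)"
    by (intro cong_add power_mod_exponent_cong assms(3))
  moreover have "e dvd q ^ i 1 + q ^ i 2 + q ^ i 3"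
    using i by (simp add: eval_nat_numeral)
  ultimately have "e dvd q ^ (i 1 mod d) + q ^ (i 2 mod d) + q ^ (i 3 mod d)"
    by (simp add: cong_dvd_iff)
  then obtain x y z where xyz: "e dvd q ^ x + q ^ y + q ^ z" "x < d" "y < d" "z < d"
    using assms(4) that[of "i 1 mod d" "i 2 mod d" "i 3 mod d"] by simp
  have sorted: ?thesis
    if abc: "a \<le> b" "b \<le> c" "c < d" and dvd: "e dvd q ^ a + q ^ b + q ^ c" for a b c
  proof -
    have "q ^ a + q ^ b + q ^ c = q ^ a * (1 + q ^ (b - a) + q ^ (c - a))"
      using abc by (simp add: algebra_simps flip: power_add)
    moreover have "coprime e (q ^ a)"
      using assms(2) by (simp add: coprime_commute)
    ultimately have "e dvd 1 + q ^ (b - a) + q ^ (c - a)"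
      using dvd coprime_dvd_mult_right_iff by metis
    then show ?thesis
      using result[of "b - a" "c - a"] abc by linarith
  qed
  consider "x \<le> y" "y \<le> z" | "x \<le> z" "z \<le> y" | "y \<le> x" "x \<le> z"
    | "y \<le> z" "z \<le> x" | "z \<le> x" "x \<le> y" | "z \<le> y" "y \<le> x"
    by linarith
  then show ?thesis
  proof cases
    case 1 then show ?thesis using xyz by (intro sorted[of x y z]) (simp_all add: ac_simps)
  next
    case 2 then show ?thesis using xyz by (intro sorted[of x z y]) (simp_all add: ac_simps)
  next
    case 3 then show ?thesis using xyz by (intro sorted[of y x z]) (simp_all add: ac_simps)
  next
    case 4 then show ?thesis using xyz by (intro sorted[of y z x]) (simp_all add: ac_simps)
  next
    case 5 then show ?thesis using xyz by (intro sorted[of z x y]) (simp_all add: ac_simps)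
  next
    case 6 then show ?thesis using xyz by (intro sorted[of z y x]) (simp_all add: ac_simps)
  qed
qed

lemma min_power_sum_le_geometric:
  assumes "d > 0" "e dvd (\<Sum>r<d. q ^ r)"
  shows "min_power_sum q e \<le> d"
proof -
  have "sum_list (map ((^) q) [0..<d]) = (\<Sum>r<d. q ^ r)"
    by (simp add: interv_sum_list_conv_sum_set_nat atLeast0LessThan)
  then show ?thesis
    using min_power_sum_le_length[of "[0..<d]" e q] assms by simp
qed

lemma min_power_sum_le_2: "e dvd 1 + q ^ r \<Longrightarrow> min_power_sum q e \<le> 2"
  using min_power_sum_le_length[of "[0, r]" e q] by simp

section \<open>Relations modulo \<open>e\<close> among small powers of \<open>q\<close>\<close>

lemma cong_power_gcd_1:
  assumes "[q ^ a = 1] (mod e)" "[q ^ b = 1] (mod e)"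
  shows "[q ^ gcd a b = 1] (mod (e::nat))"
  using assms unfolding ord_divides by simp

text \<open>
  The hypotheses \<open>e dvd \<dots>\<close> run through all sums \<open>1 + q\<^sup>r + q\<^sup>s\<close> with \<open>r \<le> s \<le> 3\<close> except \<open>r = s = 0\<close>: for
  \<open>d = 4\<close> each of them forces a shorter relation, so \<open>m = 3\<close> cannot occur unless \<open>q \<equiv> 1\<close>.
\<close>

lemma int_three_term_relations:
  fixes q e :: int
  assumes "e dvd 1 + q + q^2 + q^3"
  shows "e dvd 2 + q \<Longrightarrow> e dvd 1 + q^2"
    and "e dvd 1 + 2 * q \<Longrightarrow> e dvd 1 + q^2"
    and "e dvd 2 + q^2 \<Longrightarrow> e dvd 1 + q"
    and "e dvd 1 + 2 * q^2 \<Longrightarrow> e dvd 1 + q"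
    and "e dvd 2 + q^3 \<Longrightarrow> e dvd 1 + q^2"
    and "e dvd 1 + 2 * q^3 \<Longrightarrow> e dvd 1 + q^2"
    and "e dvd 1 + q + q^2 \<Longrightarrow> e dvd q^3"
    and "e dvd 1 + q + q^3 \<Longrightarrow> e dvd q^2"
    and "e dvd 1 + q^2 + q^3 \<Longrightarrow> e dvd q"
proof -
  let ?S = "1 + q + q^2 + q^3"
  \<comment> \<open>Each target is written as a combination of \<open>?S\<close> and the second
    hypothesis. The first six identities rest on ?S = (1 + q)(1 + q^2), and the two involving
    \<open>q^3\<close> also on (q - 1) ?S = q^4 - 1; the last three are plain differences.\<close>
  have "1 + q^2 = (1 + q^2) * (2 + q) - ?S"
    "1 + q^2 = 2 * ?S - (1 + q^2) * (1 + 2 * q)"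
    "1 + q = (1 + q) * (2 + q^2) - ?S"
    "1 + q = 2 * ?S - (1 + q) * (1 + 2 * q^2)"
    "1 + q^2 = (2 + (1 + q^2) * (q - 1)) * ?S - (1 + q^2) * q * (2 + q^3)"
    "1 + q^2 = (1 + q^2) * q * (1 + 2 * q^3) - (1 + 2 * (1 + q^2) * (q - 1)) * ?S"
    "q^3 = ?S - (1 + q + q^2)"
    "q^2 = ?S - (1 + q + q^3)"
    "q = ?S - (1 + q^2 + q^3)"
    by (simp_all add: algebra_simps eval_nat_numeral)
  note eqs = this
  show "e dvd 2 + q \<Longrightarrow> e dvd 1 + q^2"
    by (subst eqs(1)) (intro dvd_diff dvd_mult assms)
  show "e dvd 1 + 2 * q \<Longrightarrow> e dvd 1 + q^2"
    by (subst eqs(2)) (intro dvd_diff dvd_mult assms)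
  show "e dvd 2 + q^2 \<Longrightarrow> e dvd 1 + q"
    by (subst eqs(3)) (intro dvd_diff dvd_mult assms)
  show "e dvd 1 + 2 * q^2 \<Longrightarrow> e dvd 1 + q"
    by (subst eqs(4)) (intro dvd_diff dvd_mult assms)
  show "e dvd 2 + q^3 \<Longrightarrow> e dvd 1 + q^2"
    by (subst eqs(5)) (intro dvd_diff dvd_mult assms)
  show "e dvd 1 + 2 * q^3 \<Longrightarrow> e dvd 1 + q^2"
    by (subst eqs(6)) (intro dvd_diff dvd_mult assms)
  show "e dvd 1 + q + q^2 \<Longrightarrow> e dvd q^3"
    by (subst eqs(7)) (intro dvd_diff dvd_mult assms)
  show "e dvd 1 + q + q^3 \<Longrightarrow> e dvd q^2"
    by (subst eqs(8)) (intro dvd_diff dvd_mult assms)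
  show "e dvd 1 + q^2 + q^3 \<Longrightarrow> e dvd q"
    by (subst eqs(9)) (intro dvd_diff dvd_mult assms)
qed

text \<open>In this form both the quotient of q^d - 1 by q - 1 and the congruence of q^d with 1 can
  be read off.\<close>

lemma power_eq_geometric_sum_nat:
  assumes "q > (0::nat)"
  shows "q ^ d = (q - 1) * (\<Sum>r<d. q ^ r) + 1"
proof -
  obtain p where "q = Suc p"
    using assms gr0_implies_Suc by blast
  then show ?thesis
    by (induction d) (auto simp: algebra_simps)
qed

text \<open>Transfer of the integer identities, which need subtraction. In the last three,
  \<open>e\<close> divides a power of \<open>q\<close>, so coprimality leaves only e = 1.\<close>

lemma nat_three_term_relations:
  fixes q e :: nat
  assumes "e dvd 1 + q + q^2 + q^3" and "coprime q e"
  shows "e dvd 2 + q \<Longrightarrow> e dvd 1 + q^2"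
    and "e dvd 1 + 2 * q \<Longrightarrow> e dvd 1 + q^2"
    and "e dvd 2 + q^2 \<Longrightarrow> e dvd 1 + q"
    and "e dvd 1 + 2 * q^2 \<Longrightarrow> e dvd 1 + q"
    and "e dvd 2 + q^3 \<Longrightarrow> e dvd 1 + q^2"
    and "e dvd 1 + 2 * q^3 \<Longrightarrow> e dvd 1 + q^2"
    and "e dvd 1 + q + q^2 \<Longrightarrow> e = 1"
    and "e dvd 1 + q + q^3 \<Longrightarrow> e = 1"
    and "e dvd 1 + q^2 + q^3 \<Longrightarrow> e = 1"
proof -
  have "int e dvd 1 + int q + int q^2 + int q^3"
    using assms(1) by (metis int_dvd_int_iff of_nat_1 of_nat_add of_nat_power)
  note * = int_three_term_relations[OF this]
  have cop: "e = 1" if "e dvd q ^ k" for k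
    using coprime_common_divisor_nat[of "q ^ k" e e] assms(2) that by simp
  have 1: "int (1 + q^2) = 1 + int q^2" "int (1 + q) = 1 + int q"
    "int (2 + q) = 2 + int q" "int (1 + 2 * q) = 1 + 2 * int q" "int (2 + q^2) = 2 + int q^2"
    "int (1 + 2 * q^2) = 1 + 2 * int q^2" "int (2 + q^3) = 2 + int q^3" "int (1 + 2 * q^3) = 1 + 2 * int q^3"
    "int (1 + q + q^2) = 1 + int q + int q^2" "int (1 + q + q^3) = 1 + int q + int q^3"
    "int (1 + q^2 + q^3) = 1 + int q^2 + int q^3"
    by simp_all
  show "e dvd 2 + q \<Longrightarrow> e dvd 1 + q^2"
    using *(1) unfolding 1[symmetric] int_dvd_int_iff by blast
  show "e dvd 1 + 2 * q \<Longrightarrow> e dvd 1 + q^2"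
    using *(2) unfolding 1[symmetric] int_dvd_int_iff by blast
  show "e dvd 2 + q^2 \<Longrightarrow> e dvd 1 + q"
    using *(3) unfolding 1[symmetric] int_dvd_int_iff by blast
  show "e dvd 1 + 2 * q^2 \<Longrightarrow> e dvd 1 + q"
    using *(4) unfolding 1[symmetric] int_dvd_int_iff by blast
  show "e dvd 2 + q^3 \<Longrightarrow> e dvd 1 + q^2"
    using *(5) unfolding 1[symmetric] int_dvd_int_iff by blast
  show "e dvd 1 + 2 * q^3 \<Longrightarrow> e dvd 1 + q^2"
    using *(6) unfolding 1[symmetric] int_dvd_int_iff by blast
  show "e dvd 1 + q + q^2 \<Longrightarrow> e = 1"
    using *(7) cop[of 3] unfolding 1(9-11)[symmetric] unfolding of_nat_power[symmetric] int_dvd_int_iff by blast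
  show "e dvd 1 + q + q^3 \<Longrightarrow> e = 1"
    using *(8) cop[of 2] unfolding 1(9-11)[symmetric] unfolding of_nat_power[symmetric] int_dvd_int_iff by blast
  show "e dvd 1 + q^2 + q^3 \<Longrightarrow> e = 1"
    using *(9) cop[of 1] unfolding 1(9-11)[symmetric] int_dvd_int_iff power_one_right by blast
qed

lemma dvd_pred_iff_cong_1: "q > 0 \<Longrightarrow> e dvd q - 1 \<longleftrightarrow> [q = 1] (mod (e::nat))"
  by (simp add: cong_altdef_nat)

lemma dvd_3_nat:
  assumes "x dvd (3::nat)"
  shows "x = 1 \<or> x = 3"
proof -
  have "x \<le> 3" "x \<noteq> 0" "x \<noteq> 2"
    using dvd_imp_le[OF assms] dvd_pos_nat[OF _ assms] assms by auto
  then show ?thesis by linarith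
qed

lemma dvd_4_nat:
  assumes "x dvd (4::nat)"
  shows "x = 1 \<or> x = 2 \<or> x = 4"
proof -
  have "x \<le> 4" "x \<noteq> 0" "x \<noteq> 3"
    using dvd_imp_le[OF assms] dvd_pos_nat[OF _ assms] assms by auto
  then show ?thesis by linarith
qed

text \<open>If e = 2, coprimality makes \<open>q\<close> odd. This rules out \<open>e dvd 2\<close>
  whenever \<open>q\<close> is not 1 modulo \<open>e\<close>.\<close>

lemma dvd_2_imp_dvd_pred:
  fixes q e :: nat
  assumes "e dvd 2" "coprime q e" "q > 0"
  shows "e dvd q - 1"
proof -
  have "e = 1 \<or> e = 2"
    using assms(1) by (metis prime_nat_iff two_is_prime_nat)
  then show ?thesis
    using assms by (auto simp: coprime_right_2_iff_odd)
qed

text \<open>Suppose \<open>q\<close> is not 1 modulo \<open>e\<close>. Since \<open>q\<close> to the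
  power gcd(n, d) is 1 modulo \<open>e\<close>, this gcd is not 1, which restricts \<open>n\<close>;
  moreover 2 <= m <= d, and a shortest relation is examined for each remaining \<open>m\<close>. The
  alternatives are exactly the situations for which packings are built below.\<close>

lemma min_power_sum_cases:
  fixes q n e d m :: nat
  defines "m \<equiv> min_power_sum q e"
  assumes "e \<ge> 1" "q > 1" "n \<ge> 1" and en: "e dvd q ^ n - 1"
    and d: "d \<in> {2, 3, 4}" and ed: "e dvd (q ^ d - 1) div (q - 1)"
  shows "e dvd q - 1 \<or> m dvd n \<and> e dvd (\<Sum>r<m. q ^ r) \<or> m = 2 \<and> 4 dvd n \<and> e dvd 1 + q\<^sup>2
    \<or> m = 4 \<and> even n \<and> odd q \<and> e dvd 2 * (1 + q)"
proof (cases "e dvd q - 1")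
  case False
  have S: "e dvd (\<Sum>r<d. q ^ r)"
    using ed assms(3) by (simp add: power_eq_geometric_sum_nat[of q d])
  have qn: "[q ^ n = 1] (mod e)"
    using en assms(3) by (simp add: cong_altdef_nat)
  have "q ^ d - 1 = (q - 1) * (\<Sum>r<d. q ^ r)"
    using assms(3) by (simp add: power_eq_geometric_sum_nat[of q d])
  then have qd: "[q ^ d = 1] (mod e)"
    using S assms(3) by (simp add: cong_altdef_nat)
  have cop: "coprime q e"
    using cong_imp_coprime[OF cong_sym[OF qn]] assms(4) by simp
  have gcd: "[q ^ gcd n d = 1] (mod e)"
    by (rule cong_power_gcd_1[OF qn qd])
  have g: "gcd n d \<noteq> 1"
    using gcd False dvd_pred_iff_cong_1[of q e] assms(3) by auto
  have m0: "m > 0" and m1: "m \<noteq> 1"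
    using min_power_sum_pos[OF assms(2)] min_power_sum_eq_1[OF cop assms(2)] False
    by (auto simp: m_def)
  have md: "m \<le> d"
    using min_power_sum_le_geometric[OF _ S] d by (auto simp: m_def)
  from d consider "d = 2" | "d = 3" | "d = 4" by blast
  then show ?thesis
  proof cases
    case 1
    then have "m = 2" using m0 m1 md by linarith
    moreover have "even n"
      using g 1 by (metis coprime_iff_gcd_eq_1 coprime_right_2_iff_odd)
    ultimately show ?thesis using S 1 by simp
  next
    case 2
    \<comment> \<open>For r = 1, 2, subtracting 1 + q^r from 1 + q + q^2 leaves a power of
      \<open>q\<close>, forcing e = 1; for r = 0, \<open>e dvd 2\<close> makes \<open>q\<close>
      congruent to 1.\<close>
    have "m \<noteq> 2"
    proof
      assume "m = 2"
      with min_power_sum_eq_2[OF assms(2) cop qd] 2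
      obtain r where r: "r < 3" "e dvd 1 + q ^ r" by (auto simp: m_def)
      have S3: "e dvd 1 + q + q\<^sup>2" using S 2 by (simp add: eval_nat_numeral)
      consider "r = 0" | "r = 1" | "r = 2" using r(1) by linarith
      then show False
      proof cases
        case 1
        then have "e dvd q - 1"
          using r(2) assms(3) by (intro dvd_2_imp_dvd_pred[OF _ cop]) (auto simp: numeral_2_eq_2)
        with False show ?thesis by blast
      next
        case 2
        then have "e dvd q\<^sup>2" using S3 r(2) 2 dvd_add_right_iff[of e "1 + q" "q\<^sup>2"] by simp
        then have "e = 1" using coprime_common_divisor_nat[of "q ^ 2" e e] cop by simp
        then show ?thesis using False by simp
      next
        case 3
        then have "e dvd q" using S3 r(2) 3 dvd_add_right_iff[of e "1 + q\<^sup>2" q] by (simp add: ac_simps)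
        then have "e = 1" using coprime_common_divisor_nat[of "q" e e] cop by simp
        then show ?thesis using False by simp
      qed
    qed
    then have "m = 3" using 2 m0 m1 md by linarith
    moreover have "3 dvd n"
      using g 2 dvd_3_nat[of "gcd n 3"] by (metis gcd_dvd1 gcd_dvd2)
    ultimately show ?thesis using S 2 by simp
  next
    case 3
    have S4: "e dvd 1 + q + q^2 + q^3"
      using S 3 by (simp add: eval_nat_numeral algebra_simps)
    note q4 = qd[unfolded 3]
    have "even n"
    proof (rule ccontr)
      assume "odd n"
      then have "coprime n (2 ^ 2)"
        unfolding coprime_power_right_iff coprime_right_2_iff_odd by simp
      then show False using g 3 by simp
    qed
    \<comment> \<open>Here gcd(n, 4) can only be 2.\<close>
    have q2: "[q\<^sup>2 = 1] (mod e)" if "\<not> 4 dvd n"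
    proof -
      have "gcd n 4 dvd (4::nat)" "gcd n 4 \<noteq> 1"
        using g 3 by auto
      moreover have "gcd n 4 \<noteq> 4"
        using that by (metis gcd_dvd1)
      ultimately have "gcd n 4 = 2" using dvd_4_nat by blast
      then show ?thesis using gcd 3 by simp
    qed
    have e2: "\<not> e dvd 2"
      using dvd_2_imp_dvd_pred[of e q] cop assms(3) False by auto
    consider "m = 2" | "m = 3" | "m = 4" using 3 m0 m1 md by linarith
    then show ?thesis
    proof cases
      case 1
      with min_power_sum_eq_2[OF assms(2) cop q4]
      obtain r where r: "r < 4" "e dvd 1 + q ^ r" by (auto simp: m_def)
      have plus: ?thesis if "e dvd 1 + q"
        using that 1 \<open>even n\<close> by (simp add: eval_nat_numeral)
      consider "r = 0" | "r = 1" | "r = 2" | "r = 3" using r(1) by linarith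
      then show ?thesis
      proof cases
        case 1 then show ?thesis using r(2) e2 by (simp add: numeral_2_eq_2)
      next
        case 2 then show ?thesis using r(2) plus by simp
      next
        case 3
        \<comment> \<open>Otherwise q^2 is congruent to 1 and the relation 1 + q^2 collapses to
          2.\<close>
        have "4 dvd n"
        proof (rule ccontr)
          assume "\<not> 4 dvd n"
          from cong_add[OF cong_refl[of 1] q2[OF this]] have "[1 + q\<^sup>2 = 2] (mod e)"
            by (simp add: numeral_2_eq_2)
          then show False using r(2) 3 e2 cong_dvd_iff by blast
        qed
        then show ?thesis using r(2) 3 1 \<open>m = 2\<close> by simp
      next
        case 4
        \<comment> \<open>Multiplication by \<open>q\<close> shifts exponents cyclically modulo 4,
          which turns 1 + q^3 into 1 + q.\<close>
        have "q * (1 + q ^ 3) = q + q ^ 4" by (simp add: algebra_simps eval_nat_numeral)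
        moreover have "[q + q ^ 4 = q + 1] (mod e)" by (intro cong_add q4 cong_refl)
        moreover have "e dvd q * (1 + q ^ 3)" using dvd_mult[OF r(2), of q] 4 by simp
        ultimately have "e dvd q + 1" by (metis cong_dvd_iff)
        then show ?thesis using plus by simp
      qed
    next
      case 2
      with min_power_sum_eq_3[OF assms(2) cop q4]
      obtain r s where rs: "r \<le> s" "s < 4" "e dvd 1 + q ^ r + q ^ s" by (auto simp: m_def)
      have no: "\<not> e dvd 1 + q" "\<not> e dvd 1 + q\<^sup>2"
        using min_power_sum_le_2[of e q 1] min_power_sum_le_2[of e q 2] 2 by (auto simp: m_def)
      have e1: "e \<noteq> 1" using e2 by auto
      note contra = nat_three_term_relations[OF S4 cop]
      have "r = 0 \<or> r = 1 \<or> r = 2 \<or> r = 3" "s = 0 \<or> s = 1 \<or> s = 2 \<or> s = 3"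
        using rs(1,2) by linarith+
      then consider "r = 0 \<and> s = 0" | "r = 0 \<and> s = 1" | "r = 0 \<and> s = 2" | "r = 0 \<and> s = 3" | "r = 1 \<and> s = 1"
        | "r = 1 \<and> s = 2" | "r = 1 \<and> s = 3" | "r = 2 \<and> s = 2" | "r = 2 \<and> s = 3" | "r = 3 \<and> s = 3"
        using rs(1) by (elim disjE) simp_all
      then show ?thesis
      proof cases
        case 1
        \<comment> \<open>Now e = 3, and coprimality makes \<open>q\<close> congruent to 1 or -1
          modulo 3; both are already excluded.\<close>
        then have "e dvd 3" using rs(3) by (simp add: numeral_3_eq_3)
        then have "e = 3" using e1 dvd_3_nat by blast
        have "\<not> 3 dvd q" using cop \<open>e = 3\<close> coprime_common_divisor_nat[of q 3 3] by auto
        then have "3 dvd q - 1 \<or> 3 dvd 1 + q" by presburger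
        then show ?thesis using no False \<open>e = 3\<close> by simp
      \<comment> \<open>When r = s, the equal powers must be merged into 2 q^r to match the listed
        relations.\<close>
      qed (use rs(3) contra no e1 in \<open>simp_all flip: mult_2\<close>)
    next
      case 3
      show ?thesis
      proof (cases "4 dvd n")
        case True
        then show ?thesis using 3 S \<open>d = 4\<close> by simp
      next
        case False
        \<comment> \<open>With q^2 congruent to 1, the geometric sum becomes 2 (1 + q). As m = 4
          forbids \<open>e dvd 1 + q\<close>, the factor 2 cannot be cancelled, so \<open>e\<close>
          is even and \<open>q\<close> odd.\<close>
        have "[1 + q + q^2 + q * q^2 = 1 + q + 1 + q * 1] (mod e)"
          by (intro cong_add cong_mult cong_refl q2 False)
        moreover have "1 + q + q^2 + q * q^2 = 1 + q + q^2 + q^3" "1 + q + 1 + q * 1 = 2 * (1 + q)"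
          by (simp_all add: eval_nat_numeral)
        ultimately have 2: "e dvd 2 * (1 + q)" using S4 by (metis cong_dvd_iff)
        have "\<not> e dvd 1 + q"
          using min_power_sum_le_2[of e q 1] 3 by (auto simp: m_def)
        have "odd q"
        proof
          assume "even q"
          have "odd e"
          proof
            assume "even e"
            then show False using \<open>even q\<close> cop coprime_common_divisor_nat[of q e 2] by simp
          qed
          then have "coprime e 2" by simp
          then have "e dvd 1 + q" using 2 coprime_dvd_mult_right_iff by blast
          then show False using \<open>\<not> e dvd 1 + q\<close> by blast
        qed
        then show ?thesis using 2 3 \<open>even n\<close> by simp
      qed
    qed
  qed
qed simp

section \<open>Packings of digit vectors\<close>

text \<open>By disjointness \<open>j\<close> lies in at most one block \<open>S a\<close>, and only
  the \<open>h\<close> indices k with k div h = a use that block.\<close>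

lemma sum_le_block_bound:
  fixes S :: "nat \<Rightarrow> nat set"
  assumes "disjoint_family S" "h > 0"
  shows "(\<Sum>k<K. if j \<in> S (k div h) then c else 0) \<le> (h * c :: nat)"
proof (cases "\<exists>a. j \<in> S a")
  case True
  then obtain a where a: "j \<in> S a" by blast
  have "k \<in> {a * h..<a * h + h}" if "j \<in> S (k div h)" for k
  proof -
    have "k div h = a"
      using that a assms(1) by (auto simp: disjoint_family_on_def)
    then show ?thesis
      using dividend_less_div_times[OF assms(2), of k] by (auto simp: add.commute)
  qed
  then have sub: "{k. k < K \<and> j \<in> S (k div h)} \<subseteq> {a * h..<a * h + h}"
    by blast
  have "(\<Sum>k<K. if j \<in> S (k div h) then c else 0) = card {k. k < K \<and> j \<in> S (k div h)} * c"
    by (simp add: sum.If_cases Int_def)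
  then show ?thesis
    using card_mono[OF _ sub] by simp
qed auto

text \<open>
  A packing is a family of \<open>K\<close> nonzero digit vectors of values divisible by \<open>e\<close> whose sum has all
  entries below \<open>q\<close>, i.e. a nonzero product of \<open>K\<close> nonconstant monomials of \<open>A(q,n,e)\<close>.
\<close>

definition packing :: "nat \<Rightarrow> nat \<Rightarrow> nat \<Rightarrow> nat \<Rightarrow> (nat \<Rightarrow> nat \<Rightarrow> nat) \<Rightarrow> bool" where
  "packing q n e K v \<longleftrightarrow>
    (\<forall>k<K. e dvd (\<Sum>j = 1..n. q ^ (j - 1) * v k j) \<and> (\<exists>j\<in>{1..n}. v k j > 0)) \<and>
    (\<forall>j\<in>{1..n}. (\<Sum>k<K. v k j) < q)"

text \<open>Common construction: each of \<open>N\<close> disjoint blocks carries an admissible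
  monomial with constant exponent \<open>c\<close>, used \<open>h\<close> times, so every exponent
  of the product is at most h c.\<close>

lemma packing_blocks:
  assumes "\<And>a. a < N \<Longrightarrow> S a \<subseteq> {1..n}" "\<And>a. a < N \<Longrightarrow> S a \<noteq> {}"
    and "disjoint_family S"
    and "\<And>a. a < N \<Longrightarrow> e dvd c * (\<Sum>j\<in>S a. q ^ (j - 1))"
    and "h * c < q" "c > 0" "h > 0"
  shows "packing q n e (N * h) (\<lambda>k j. if j \<in> S (k div h) then c else 0)"
  unfolding packing_def
proof (intro conjI allI impI ballI)
  fix k assume "k < N * h"
  then have k: "k div h < N"
    by (simp add: less_mult_imp_div_less)
  have "(\<Sum>j = 1..n. q ^ (j - 1) * (if j \<in> S (k div h) then c else 0))
      = (\<Sum>j\<in>S (k div h). q ^ (j - 1) * c)"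
    using assms(1)[OF k] by (intro sum.mono_neutral_cong_right) auto
  also have "\<dots> = c * (\<Sum>j\<in>S (k div h). q ^ (j - 1))"
    by (simp add: sum_distrib_left mult.commute)
  finally show "e dvd (\<Sum>j = 1..n. q ^ (j - 1) * (if j \<in> S (k div h) then c else 0))"
    using assms(4)[OF k] by simp
  show "\<exists>j\<in>{1..n}. 0 < (if j \<in> S (k div h) then c else 0)"
    using assms(1,2)[OF k] assms(6) by auto
next
  fix j
  show "(\<Sum>k<N * h. if j \<in> S (k div h) then c else 0) < q"
    using sum_le_block_bound[OF assms(3,7), of j c "N * h"] assms(5) by linarith
qed

text \<open>The blocks are intervals of \<open>m\<close> consecutive positions, whose values are
  shifts of the geometric sum by powers of q^m. Each is used q - 1 times.\<close>

lemma packing_geometric: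
  assumes "m > 0" "m dvd n" "e dvd (\<Sum>r<m. q ^ r)" "q > 1"
  shows "\<exists>v. packing q n e (n * (q - 1) div m) v"
proof -
  obtain N where N: "n = m * N" using assms(2) by blast
  define S where "S a = {m * a + 1..m * a + m}" for a
  have "packing q n e (N * (q - 1)) (\<lambda>k j. if j \<in> S (k div (q - 1)) then 1 else 0)"
  proof (rule packing_blocks)
    fix a assume a: "a < N"
    then have "m * a + m \<le> n"
      using mult_le_mono2[of "a + 1" N m] N by (simp add: algebra_simps)
    then show "S a \<subseteq> {1..n}" by (auto simp: S_def)
    show "S a \<noteq> {}" using assms(1) by (auto simp: S_def)
    have "(\<Sum>j\<in>S a. q ^ (j - 1)) = (\<Sum>r<m. q ^ (m * a + r))"
      unfolding S_def
      by (rule sum.reindex_bij_witness[of _ "\<lambda>r. m * a + r + 1" "\<lambda>j. j - 1 - m * a"]) auto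
    also have "\<dots> = q ^ (m * a) * (\<Sum>r<m. q ^ r)"
      by (simp add: sum_distrib_left power_add)
    finally show "e dvd 1 * (\<Sum>j\<in>S a. q ^ (j - 1))"
      using assms(3) by simp
  next
    have "a = (j - 1) div m" if "j \<in> S a" for j a
      using that assms(1) by (intro div_nat_eqI[symmetric]) (auto simp: S_def algebra_simps)
    then show "disjoint_family S"
      unfolding disjoint_family_on_def by blast
  qed (use assms in auto)
  moreover have "n * (q - 1) div m = N * (q - 1)"
    using N assms(1) by (simp add: mult.assoc)
  ultimately show ?thesis by auto
qed

text \<open>Each group of four positions splits into two pairs at distance two, and a shift of 1 +
  q^2 is the value of such a pair.\<close>

lemma packing_alternating:
  assumes "4 dvd n" "e dvd 1 + q\<^sup>2" "q > 1"
  shows "\<exists>v. packing q n e (n * (q - 1) div 2) v"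
proof -
  obtain N where N: "n = 4 * N" using assms(1) by blast
  \<comment> \<open>Zero-based first position of pair \<open>a\<close>: two pairs per group of four,
    starting at offsets 0 and 1.\<close>
  define p where "p a = 4 * (a div 2) + a mod 2" for a :: nat
  define S where "S a = {p a + 1, p a + 3}" for a :: nat
  have "packing q n e (2 * N * (q - 1)) (\<lambda>k j. if j \<in> S (k div (q - 1)) then 1 else 0)"
  proof (rule packing_blocks)
    fix a assume a: "a < 2 * N"
    then have "p a + 3 \<le> n"
      unfolding p_def N by presburger
    then show "S a \<subseteq> {1..n}" by (auto simp: S_def)
    show "S a \<noteq> {}" by (auto simp: S_def)
    have "(\<Sum>j\<in>S a. q ^ (j - 1)) = q ^ p a * (1 + q\<^sup>2)"
      by (simp add: S_def algebra_simps power_add eval_nat_numeral)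
    then show "e dvd 1 * (\<Sum>j\<in>S a. q ^ (j - 1))"
      using assms(2) by (metis dvd_mult)
  next
    \<comment> \<open>Both members of a pair share their group of four and their parity, and these
      two data determine the pair.\<close>
    have "a = 2 * ((j - 1) div 4) + (j - 1) mod 2" if "j \<in> S a" for a j
    proof -
      obtain b r where br: "a = 2 * b + r" "r < 2"
        by (metis mod_less_divisor mult_div_mod_eq pos2)
      then have "j - 1 = 4 * b + r \<or> j - 1 = 4 * b + (r + 2)"
        using \<open>j \<in> S a\<close> by (auto simp: S_def p_def)
      moreover have "(4 * b + r) mod 2 = r mod 2" "(4 * b + (r + 2)) mod 2 = r mod 2"
        by presburger+
      ultimately have "(j - 1) div 4 = b \<and> (j - 1) mod 2 = r"
        using br(2) by auto
      then show ?thesis using br(1) by simp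
    qed
    then show "disjoint_family S"
      unfolding disjoint_family_on_def by blast
  qed (use assms in auto)
  moreover have "n * (q - 1) div 2 = 2 * N * (q - 1)"
    using N by simp
  ultimately show ?thesis by auto
qed

text \<open>The admissible monomial has exponent 2 on two adjacent positions. As \<open>q\<close> is
  odd, q - 1 = 2 h, so \<open>h\<close> copies use up each pair exactly.\<close>

lemma packing_double_pairs:
  assumes "even n" "odd q" "q > 1" "e dvd 2 * (1 + q)"
  shows "\<exists>v. packing q n e (n * (q - 1) div 4) v"
proof -
  obtain N where N: "n = 2 * N" using assms(1) by blast
  obtain h where h: "q = 2 * h + 1" using assms(2) oddE by blast
  define S where "S a = {2 * a + 1, 2 * a + 2}" for a :: nat
  have "packing q n e (N * h) (\<lambda>k j. if j \<in> S (k div h) then 2 else 0)"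
  proof (rule packing_blocks)
    fix a assume a: "a < N"
    then show "S a \<subseteq> {1..n}" by (auto simp: S_def N)
    show "S a \<noteq> {}" by (auto simp: S_def)
    have "2 * (\<Sum>j\<in>S a. q ^ (j - 1)) = q ^ (2 * a) * (2 * (1 + q))"
      by (simp add: S_def algebra_simps)
    then show "e dvd 2 * (\<Sum>j\<in>S a. q ^ (j - 1))"
      using assms(4) by (metis dvd_mult)
  next
    have "a = b" if "j \<in> S a" "j \<in> S b" for a b j
      using that unfolding S_def insert_iff empty_iff by presburger
    then show "disjoint_family S"
      unfolding disjoint_family_on_def by blast
  qed (use h assms(3) in auto)
  moreover have "n * (q - 1) div 4 = N * h"
    using N h by simp
  ultimately show ?thesis by auto
qed

text \<open>Modulo \<open>e\<close> the value of a digit vector is its degree, so any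
  \<open>e\<close> variable factors form an admissible monomial. The n (q - 1) available factors are
  listed position by position and cut into runs of length \<open>e\<close>.\<close>

lemma packing_cong_1:
  assumes "e > 0" "q > 1" "e dvd q - 1"
  shows "\<exists>v. packing q n e (n * (q - 1) div e) v"
proof -
  let ?K = "n * (q - 1) div e"
  \<comment> \<open>Position of the factor numbered \<open>x\<close>: factors are counted from 0,
    positions from 1, with q - 1 factors each. Then \<open>v k j\<close> counts the factors at
    \<open>j\<close> in run \<open>k\<close>.\<close>
  define f where "f x = x div (q - 1) + 1" for x
  define v where "v k j = card {x \<in> {k * e..<k * e + e}. f x = j}" for k j
  have Ke: "?K * e \<le> n * (q - 1)"
    by (simp add: div_times_less_eq_dividend)
  have q1: "[q = 1] (mod e)"
    using assms(3) dvd_pred_iff_cong_1[of q e] assms(2) by simp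
  have "packing q n e ?K v"
    unfolding packing_def
  proof (intro conjI allI impI ballI)
    fix k assume "k < ?K"
    then have "k * e + e \<le> ?K * e"
      using mult_le_mono1[of "k + 1" ?K e] by simp
    then have "f x \<in> {1..n}" if "x \<in> {k * e..<k * e + e}" for x
    proof -
      have "x < n * (q - 1)"
        using that Ke \<open>k * e + e \<le> ?K * e\<close> by (meson atLeastLessThan_iff less_le_trans)
      then show ?thesis
        by (simp add: f_def Suc_le_eq less_mult_imp_div_less)
    qed
    then have "f ` {k * e..<k * e + e} \<subseteq> {1..n}" by blast
    then have "(\<Sum>j = 1..n. \<Sum>x \<in> {x \<in> {k * e..<k * e + e}. f x = j}. 1) = (\<Sum>x \<in> {k * e..<k * e + e}. 1 :: nat)"
      by (intro sum.group) auto
    then have sum: "(\<Sum>j = 1..n. v k j) = e"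
      by (simp add: v_def)
    have "[(\<Sum>j = 1..n. q ^ (j - 1) * v k j) = (\<Sum>j = 1..n. 1 * v k j)] (mod e)"
      by (intro cong_sum cong_mult power_cong_1 q1 cong_refl)
    from cong_dvd_iff[OF this] show "e dvd (\<Sum>j = 1..n. q ^ (j - 1) * v k j)"
      using sum by simp
    show "\<exists>j\<in>{1..n}. 0 < v k j"
    proof (rule ccontr)
      assume "\<not> ?thesis"
      then have "(\<Sum>j = 1..n. v k j) = 0" by (intro sum.neutral) auto
      then show False using sum assms(1) by simp
    qed
  next
    fix j assume j: "j \<in> {1..n}"
    have "(\<Sum>k<?K. v k j) = card (\<Union>k<?K. {x \<in> {k * e..<k * e + e}. f x = j})"
      unfolding v_def
    proof (rule card_UN_disjoint[symmetric])
      have "k = x div e" if "x \<in> {k * e..<k * e + e}" for k x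
        using that by (intro div_nat_eqI[symmetric]) (auto simp: algebra_simps)
      then show "\<forall>k\<in>{..<?K}. \<forall>l\<in>{..<?K}. k \<noteq> l \<longrightarrow>
          {x \<in> {k * e..<k * e + e}. f x = j} \<inter> {x \<in> {l * e..<l * e + e}. f x = j} = {}"
        by blast
    qed auto
    \<comment> \<open>The runs are disjoint, and the factors at position \<open>j\<close> form an
      interval of length q - 1.\<close>
    also have "\<dots> \<le> card {(j - 1) * (q - 1)..<(j - 1) * (q - 1) + (q - 1)}"
    proof (intro card_mono subsetI)
      fix x assume "x \<in> (\<Union>k<?K. {x \<in> {k * e..<k * e + e}. f x = j})"
      then have "x div (q - 1) = j - 1" by (auto simp: f_def)
      then show "x \<in> {(j - 1) * (q - 1)..<(j - 1) * (q - 1) + (q - 1)}"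
        using assms(2) dividend_less_div_times[of "q - 1" x] div_times_less_eq_dividend[of x "q - 1"]
        by (simp add: add.commute del: div_times_less_eq_dividend)
    qed auto
    finally show "(\<Sum>k<?K. v k j) < q"
      using assms(2) by simp
  qed
  then show ?thesis by blast
qed

lemma ex_packing:
  fixes q n e :: nat
  assumes "e \<ge> 1" "q > 1" "n \<ge> 1" "e dvd q ^ n - 1"
    and "\<exists>d \<in> {2, 3, 4 :: nat}. e dvd (q ^ d - 1) div (q - 1)"
  shows "\<exists>v. packing q n e (n * (q - 1) div min_power_sum q e) v"
proof -
  obtain d where "d \<in> {2, 3, 4 :: nat}" "e dvd (q ^ d - 1) div (q - 1)"
    using assms(5) by blast
  from min_power_sum_cases[OF assms(1-4) this]
  consider "e dvd q - 1" | "min_power_sum q e dvd n" "e dvd (\<Sum>r<min_power_sum q e. q ^ r)"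
    | "min_power_sum q e = 2" "4 dvd n" "e dvd 1 + q\<^sup>2"
    | "min_power_sum q e = 4" "even n" "odd q" "e dvd 2 * (1 + q)"
    by blast
  then show ?thesis
  proof cases
    case 1
    then show ?thesis
      using packing_cong_1[of e q n] min_power_sum_dvd_pred[OF assms(1,2) 1] assms(1,2) by simp
  next
    case 2
    then show ?thesis
      using packing_geometric min_power_sum_pos[OF assms(1)] assms(2) by blast
  next
    case 3
    then show ?thesis
      using packing_alternating[of n e q] assms(2) by simp
  next
    case 4
    then show ?thesis
      using packing_double_pairs[of n q e] assms(2) by simp
  qed
qed

section \<open>Polynomials supported on sets of monomials\<close>

text \<open>Negatives come for free, as multiples by -1.\<close>

lemma (in cring) ideal_of_closed:
  assumes "H \<subseteq> carrier R" "\<zero> \<in> H"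
    and "\<And>x y. x \<in> H \<Longrightarrow> y \<in> H \<Longrightarrow> x \<oplus> y \<in> H"
    and mult: "\<And>a x. a \<in> carrier R \<Longrightarrow> x \<in> H \<Longrightarrow> a \<otimes> x \<in> H"
  shows "ideal H R"
proof (rule idealI)
  show "ring R" by (rule ring_axioms)
  show "subgroup H (add_monoid R)"
  proof (rule add.subgroupI)
    fix x assume x: "x \<in> H"
    then have "\<ominus> x = (\<ominus> \<one>) \<otimes> x"
      using assms(1) by (simp add: l_minus subset_iff)
    then show "\<ominus> x \<in> H"
      using mult[OF _ x, of "\<ominus> \<one>"] by simp
  qed (use assms in auto)
  show "a \<otimes> x \<in> H" if "x \<in> H" "a \<in> carrier R" for x a
    using that mult by blast
  then show "x \<otimes> a \<in> H" if "x \<in> H" "a \<in> carrier R" for x a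
    using that assms(1) m_comm by (metis subsetD)
qed

lemma (in primeideal) pow_mem_imp_mem:
  assumes "x \<in> carrier R" "x [^] (k::nat) \<in> I"
  shows "x \<in> I"
  using assms(2)
proof (induction k)
  case 0
  then show ?case
    using one_imp_carrier I_notcarr by simp
next
  case (Suc k)
  then show ?case
    using I_prime[of "x [^] k" x] assms(1) by auto
qed

text \<open>The linear span of a set of monomials. The polynomial ring, the truncation ideal, and
  preimages spanning the algebra and its radical all have this shape, so ring questions reduce to
  exponent vectors.\<close>

definition supported :: "(nat \<Rightarrow>\<^sub>0 nat) set \<Rightarrow> 'a::field mpoly set" where
  "supported T = {p. Poly_Mapping.keys p \<subseteq> T}"

lemma supported_mono: "p \<in> supported T \<Longrightarrow> T \<subseteq> U \<Longrightarrow> p \<in> supported U"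
  by (auto simp: supported_def)

lemma supported_0 [simp]: "0 \<in> supported T"
  by (simp add: supported_def)

lemma supported_add: "p \<in> supported T \<Longrightarrow> r \<in> supported T \<Longrightarrow> p + r \<in> supported T"
  using Poly_Mapping.keys_add[of p r] by (auto simp: supported_def)

lemma supported_uminus: "p \<in> supported T \<Longrightarrow> - p \<in> supported T"
  by (auto simp: supported_def)

lemma supported_single: "t \<in> T \<Longrightarrow> Poly_Mapping.single t c \<in> supported T"
  by (simp add: supported_def)

lemma supported_mult:
  assumes "p \<in> supported T" "r \<in> supported U" "\<And>s t. s \<in> T \<Longrightarrow> t \<in> U \<Longrightarrow> s + t \<in> V"
  shows "p * r \<in> supported V"
  using assms Poly_Mapping.keys_mult[of p r] unfolding supported_def by blast

text \<open>Every element of the span is a finite sum of terms: updating a fresh key amounts to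
  adding a term.\<close>

lemma supported_induct [consumes 1, case_names zero single add]:
  assumes "p \<in> supported T" "P 0"
    and "\<And>t c. t \<in> T \<Longrightarrow> P (Poly_Mapping.single t c)"
    and add: "\<And>p r. p \<in> supported T \<Longrightarrow> r \<in> supported T \<Longrightarrow> P p \<Longrightarrow> P r \<Longrightarrow> P (p + r)"
  shows "P p"
  using assms(1)
proof (induction p rule: Poly_Mapping.update_induct)
  case const
  show ?case by (rule assms(2))
next
  case (update f a b)
  have "Poly_Mapping.update a b f = f + Poly_Mapping.single a b"
    using update(1) by (intro poly_mapping_eqI)
      (auto simp: Poly_Mapping.lookup_update Poly_Mapping.lookup_add Poly_Mapping.lookup_single in_keys_iff)
  moreover have "f \<in> supported T" "a \<in> T"
    using update(2,4) by (auto simp: supported_def Poly_Mapping.keys_update)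
  ultimately show ?case
    using add[of f "Poly_Mapping.single a b"] update(3) assms(3)[of a b] supported_single[of a T b]
    by simp
qed

section \<open>Exponent vectors, truncation and weight\<close>

definition monomials :: "nat \<Rightarrow> (nat \<Rightarrow>\<^sub>0 nat) set" where
  "monomials n = {t. Poly_Mapping.keys t \<subseteq> {1..n}}"

definition monomial_of :: "nat \<Rightarrow> (nat \<Rightarrow> nat) \<Rightarrow> (nat \<Rightarrow>\<^sub>0 nat)" where
  "monomial_of n i = (\<Sum>j = 1..n. Poly_Mapping.single j (i j))"

lemma lookup_monomial_of:
  "poly_mapping.lookup (monomial_of n i) j = (if j \<in> {1..n} then i j else 0)"
  by (simp add: monomial_of_def Poly_Mapping.lookup_sum Poly_Mapping.lookup_single when_def)

lemma monomial_of_in_monomials: "monomial_of n i \<in> monomials n"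
  by (auto simp: monomials_def in_keys_iff lookup_monomial_of split: if_splits)

lemma monomial_of_lookup: "t \<in> monomials n \<Longrightarrow> monomial_of n (poly_mapping.lookup t) = t"
  by (intro poly_mapping_eqI) (auto simp: monomials_def lookup_monomial_of in_keys_iff)

lemma monomials_0 [simp]: "0 \<in> monomials n"
  by (simp add: monomials_def)

lemma monomials_add: "s \<in> monomials n \<Longrightarrow> t \<in> monomials n \<Longrightarrow> s + t \<in> monomials n"
  using Poly_Mapping.keys_add[of s t] by (auto simp: monomials_def)

lemma monomials_nonzeroE:
  assumes "t \<in> monomials n" "t \<noteq> 0"
  obtains j where "j \<in> {1..n}" "poly_mapping.lookup t j > 0"
proof -
  obtain j where "poly_mapping.lookup t j \<noteq> 0"
    using assms(2) by (metis poly_mapping_eqI Poly_Mapping.lookup_zero)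
  then show ?thesis
    using that[of j] assms(1) by (auto simp: monomials_def in_keys_iff subset_iff)
qed

text \<open>The monomials that are cut off, i.e. become zero in the quotient, not the surviving
  ones.\<close>

definition truncated_monomials :: "nat \<Rightarrow> nat \<Rightarrow> (nat \<Rightarrow>\<^sub>0 nat) set" where
  "truncated_monomials q n = {t \<in> monomials n. \<exists>j\<in>{1..n}. q \<le> poly_mapping.lookup t j}"

definition weight :: "nat \<Rightarrow> nat \<Rightarrow> (nat \<Rightarrow>\<^sub>0 nat) \<Rightarrow> nat" where
  "weight q n t = (\<Sum>j = 1..n. q ^ (j - 1) * poly_mapping.lookup t j)"

text \<open>Exponents are not bounded by \<open>q\<close> here, so that these vectors form a monoid;
  truncation happens only in the quotient.\<close>

definition weight_monomials :: "nat \<Rightarrow> nat \<Rightarrow> nat \<Rightarrow> (nat \<Rightarrow>\<^sub>0 nat) set" where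
  "weight_monomials q n e = {t \<in> monomials n. e dvd weight q n t}"

lemma weight_add: "weight q n (s + t) = weight q n s + weight q n t"
  by (simp add: weight_def Poly_Mapping.lookup_add sum.distrib algebra_simps)

lemma weight_monomials_0 [simp]: "0 \<in> weight_monomials q n e"
  by (simp add: weight_monomials_def weight_def)

lemma weight_monomials_add:
  "s \<in> weight_monomials q n e \<Longrightarrow> t \<in> weight_monomials q n e \<Longrightarrow> s + t \<in> weight_monomials q n e"
  by (simp add: weight_monomials_def weight_add monomials_add)

lemma truncated_monomials_add:
  "s \<in> monomials n \<Longrightarrow> t \<in> truncated_monomials q n \<Longrightarrow> s + t \<in> truncated_monomials q n"
  by (auto simp: truncated_monomials_def monomials_add Poly_Mapping.lookup_add intro: trans_le_add2)

text \<open>Vanishing in the quotient depends on exponents only, so the coefficient of the power is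
  left implicit.\<close>

lemma supported_power_single:
  assumes "t \<in> monomials n"
  shows "Poly_Mapping.single t (c::'a::field) ^ k
    \<in> supported {s \<in> monomials n. \<forall>j. poly_mapping.lookup s j = k * poly_mapping.lookup t j}"
proof (induction k)
  case 0
  then show ?case by (simp add: supported_def)
next
  case (Suc k)
  have "Poly_Mapping.single t c \<in> supported {t}" by (simp add: supported_single)
  then show ?case
    unfolding power_Suc
    by (rule supported_mult[OF _ Suc]) (use assms in \<open>auto simp: monomials_add Poly_Mapping.lookup_add\<close>)
qed

section \<open>The truncation ideal of the polynomial ring\<close>

lemma carrier_mpoly_ring: "carrier (mpoly_ring n) = supported (monomials n)"
  by (auto simp: mpoly_ring_def supported_def monomials_def)

lemma mpoly_ring_ops [simp]:
  "x \<otimes>\<^bsub>mpoly_ring n\<^esub> y = x * y" "x \<oplus>\<^bsub>mpoly_ring n\<^esub> y = x + y"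
  "\<one>\<^bsub>mpoly_ring n\<^esub> = 1" "\<zero>\<^bsub>mpoly_ring n\<^esub> = 0"
  by (simp_all add: mpoly_ring_def)

lemma mpoly_ring_pow [simp]: "x [^]\<^bsub>mpoly_ring n\<^esub> (k::nat) = x ^ k"
  by (induction k) (simp_all add: nat_pow_def mult.commute)

lemma mpoly_var_power: "mpoly_var j ^ k = Poly_Mapping.single (Poly_Mapping.single j k) 1"
  by (induction k) (simp_all add: mpoly_var_def Poly_Mapping.mult_single flip: Poly_Mapping.single_add)

text \<open>The span of the cut-off monomials is an ideal containing the generators, and each such
  monomial is a multiple of some \<open>mpoly_var j ^ q\<close>. This makes vanishing in the
  quotient visible on the support.\<close>

lemma truncation_ideal:
  "Idl\<^bsub>mpoly_ring n\<^esub> ((\<lambda>j. mpoly_var j ^ q) ` {1..n}) = (supported (truncated_monomials q n) :: 'a::field mpoly set)"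
proof -
  interpret P: cring "mpoly_ring n :: 'a mpoly ring" by (rule mpoly_ring_cring)
  let ?Z = "supported (truncated_monomials q n) :: 'a mpoly set"
  have Zsub: "?Z \<subseteq> carrier (mpoly_ring n)"
    unfolding carrier_mpoly_ring by (auto simp: supported_def truncated_monomials_def)
  have Z: "ideal ?Z (mpoly_ring n)"
  proof (rule P.ideal_of_closed[OF Zsub])
    show "a \<otimes>\<^bsub>mpoly_ring n\<^esub> x \<in> ?Z" if "a \<in> carrier (mpoly_ring n)" "x \<in> ?Z" for a x
      using that unfolding carrier_mpoly_ring mpoly_ring_ops
      by (rule supported_mult) (rule truncated_monomials_add)
  qed (auto intro: supported_add)
  have gen: "(\<lambda>j. mpoly_var j ^ q) ` {1..n} \<subseteq> ?Z"
  proof (intro image_subsetI)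
    fix j assume "j \<in> {1..n}"
    then have "Poly_Mapping.single j q \<in> truncated_monomials q n"
      by (auto simp: truncated_monomials_def monomials_def intro!: bexI[of _ j])
    then show "mpoly_var j ^ q \<in> ?Z"
      by (simp add: mpoly_var_power supported_single)
  qed
  show ?thesis
  proof
    show "Idl\<^bsub>mpoly_ring n\<^esub> ((\<lambda>j. mpoly_var j ^ q) ` {1..n}) \<subseteq> ?Z"
      by (rule P.genideal_minimal[OF Z gen])
  next
    let ?I = "Idl\<^bsub>mpoly_ring n\<^esub> ((\<lambda>j. mpoly_var j ^ q) ` {1..n}) :: 'a mpoly set"
    interpret I: ideal ?I "mpoly_ring n"
      by (rule P.genideal_ideal[OF order_trans[OF gen Zsub]])
    show "?Z \<subseteq> ?I"
    proof
      fix p assume "p \<in> ?Z"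
      then show "p \<in> ?I"
      proof (induction rule: supported_induct)
        case zero
        then show ?case using I.zero_closed by simp
      next
        case (add p r)
        then show ?case using I.a_closed[of p r] by simp
      next
        case (single t c)
        then obtain j where j: "j \<in> {1..n}" "q \<le> poly_mapping.lookup t j" and t: "t \<in> monomials n"
          by (auto simp: truncated_monomials_def)
        \<comment> \<open>Exponent vector of the cofactor; the subtraction is exact because the
          exponent at \<open>j\<close> is at least \<open>q\<close>.\<close>
        define s where "s = t - Poly_Mapping.single j q"
        have ts: "t = s + Poly_Mapping.single j q"
          using j(2) by (intro poly_mapping_eqI)
            (auto simp: s_def Poly_Mapping.lookup_add Poly_Mapping.lookup_minus Poly_Mapping.lookup_single when_def)
        have "s \<in> monomials n"
          using t by (auto simp: s_def monomials_def in_keys_iff Poly_Mapping.lookup_minus subset_iff)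
        then have "Poly_Mapping.single s c \<in> carrier (mpoly_ring n)"
          unfolding carrier_mpoly_ring by (rule supported_single)
        moreover have "mpoly_var j ^ q \<in> ?I"
          using P.genideal_self[OF order_trans[OF gen Zsub]] j(1) by blast
        ultimately have "Poly_Mapping.single s c \<otimes>\<^bsub>mpoly_ring n\<^esub> mpoly_var j ^ q \<in> ?I"
          by (rule I.I_l_closed[rotated])
        then show ?case
          by (simp add: mpoly_var_power Poly_Mapping.mult_single ts)
      qed
    qed
  qed
qed

section \<open>The algebra and its radical\<close>

lemma single_in_monomials: "j \<in> {1..n} \<Longrightarrow> Poly_Mapping.single j k \<in> monomials n"
  by (auto simp: monomials_def split: if_splits)

text \<open>The \<open>itself\<close> parameter fixes the coefficient field, which the numerical
  parameters do not mention.\<close>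

locale truncated_setup =
  fixes q n e :: nat and field_type :: "'a::field itself"
  assumes q_gt_1: "q > 1" and e_pos: "e \<ge> 1"
begin

abbreviation "P \<equiv> mpoly_ring n :: 'a mpoly ring"
abbreviation "Q \<equiv> truncated_ring q n :: 'a mpoly set ring"
abbreviation "\<phi> \<equiv> truncated_class q n :: 'a mpoly \<Rightarrow> 'a mpoly set"
abbreviation "Z \<equiv> truncated_monomials q n"
abbreviation "W \<equiv> weight_monomials q n e"
abbreviation "A \<equiv> A_algebra q n e :: 'a mpoly set ring"

lemma W_subset: "W \<subseteq> monomials n"
  by (auto simp: weight_monomials_def)

lemma phi_def: "\<phi> p = (supported Z :: 'a mpoly set) +>\<^bsub>P\<^esub> p"
  unfolding truncated_class_def truncation_ideal ..

lemma Q_def: "Q = P Quot supported Z"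
  unfolding truncated_ring_def truncation_ideal ..

sublocale P: cring P by (rule mpoly_ring_cring)

lemma generators_subset: "(\<lambda>j. mpoly_var j ^ q) ` {1..n} \<subseteq> carrier P"
  unfolding carrier_mpoly_ring mpoly_var_power using supported_single single_in_monomials by blast

sublocale Z: ideal "supported Z" P
  unfolding truncation_ideal[symmetric] by (rule P.genideal_ideal[OF generators_subset])

sublocale phi: ring_hom_cring P Q \<phi>
proof -
  have "\<phi> = (+>\<^bsub>P\<^esub>) (supported Z)"
    by (rule ext) (rule phi_def)
  then show "ring_hom_cring P Q \<phi>"
    unfolding Q_def using Z.rcos_ring_hom_cring[OF P.is_cring] by simp
qed

lemma phi_hom:
  assumes "p \<in> carrier P" "r \<in> carrier P"
  shows "\<phi> (p * r) = \<phi> p \<otimes>\<^bsub>Q\<^esub> \<phi> r" "\<phi> (p + r) = \<phi> p \<oplus>\<^bsub>Q\<^esub> \<phi> r"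
  using phi.hom_mult[OF assms] phi.hom_add[OF assms] by simp_all

lemma phi_0: "\<phi> 0 = \<zero>\<^bsub>Q\<^esub>" and phi_1: "\<phi> 1 = \<one>\<^bsub>Q\<^esub>"
  using phi.hom_zero phi.hom_one by simp_all

lemma phi_eq_0_iff: "p \<in> carrier P \<Longrightarrow> \<phi> p = \<zero>\<^bsub>Q\<^esub> \<longleftrightarrow> p \<in> supported Z"
  using Z.rcos_const_imp_mem[of p] P.a_rcos_zero[OF Z.ideal_axioms, of p]
  by (auto simp: phi_def Q_def FactRing_def)

lemma supported_carrier: "p \<in> supported T \<Longrightarrow> T \<subseteq> monomials n \<Longrightarrow> p \<in> carrier P"
  unfolding carrier_mpoly_ring by (rule supported_mono)

text \<open>The homomorphism moves the product into the polynomial ring, where terms multiply by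
  adding exponents.\<close>

lemma finprod_var:
  assumes "J \<subseteq> {1..n}"
  shows "(\<Otimes>\<^bsub>Q\<^esub> j \<in> J. \<phi> (mpoly_var j) [^]\<^bsub>Q\<^esub> i j) = \<phi> (Poly_Mapping.single (\<Sum>j\<in>J. Poly_Mapping.single j (i j)) 1)"
proof -
  have mem: "Poly_Mapping.single (Poly_Mapping.single j k) (1::'a) \<in> carrier P" if "j \<in> J" for j k
    unfolding carrier_mpoly_ring using that assms supported_single single_in_monomials by blast
  have "\<phi> (mpoly_var j) [^]\<^bsub>Q\<^esub> i j = \<phi> (Poly_Mapping.single (Poly_Mapping.single j (i j)) 1)" if "j \<in> J" for j
  proof -
    have "mpoly_var j \<in> carrier P"
      unfolding mpoly_var_def by (rule mem[OF that])
    from phi.ring.hom_nat_pow[OF this, of "i j"] show ?thesis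
      by (simp only: mpoly_ring_pow mpoly_var_power)
  qed
  then have "(\<Otimes>\<^bsub>Q\<^esub> j \<in> J. \<phi> (mpoly_var j) [^]\<^bsub>Q\<^esub> i j)
      = (\<Otimes>\<^bsub>Q\<^esub> j \<in> J. \<phi> (Poly_Mapping.single (Poly_Mapping.single j (i j)) 1))"
    using mem by (intro phi.S.finprod_cong') auto
  also have "\<dots> = \<phi> (\<Otimes>\<^bsub>P\<^esub> j \<in> J. Poly_Mapping.single (Poly_Mapping.single j (i j)) 1)"
    using mem by (subst phi.hom_finprod) (auto simp: comp_def)
  also have "(\<Otimes>\<^bsub>P\<^esub> j \<in> J. Poly_Mapping.single (Poly_Mapping.single j (i j)) 1)
      = Poly_Mapping.single (\<Sum>j\<in>J. Poly_Mapping.single j (i j)) 1"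
    using mem
  proof (induction J rule: infinite_finite_induct)
    case (insert x F)
    then show ?case
      by (subst P.finprod_insert) (auto simp: Poly_Mapping.mult_single)
  qed auto
  finally show ?thesis .
qed

section \<open>Monomial generators and the subalgebra they span\<close>

lemma weight_monomial_of: "weight q n (monomial_of n i) = (\<Sum>j = 1..n. q ^ (j - 1) * i j)"
  unfolding weight_def by (intro sum.cong) (auto simp: lookup_monomial_of)

lemma A_monomials_eq: "(A_monomials q n e :: 'a mpoly set set) = (\<lambda>t. \<phi> (Poly_Mapping.single t 1)) ` W"
proof -
  have "(\<Otimes>\<^bsub>Q\<^esub> j \<in> {1..n}. \<phi> (mpoly_var j) [^]\<^bsub>Q\<^esub> i j) = \<phi> (Poly_Mapping.single (monomial_of n i) 1)" for i
    using finprod_var[of "{1..n}" i] by (simp add: monomial_of_def)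
  then have "(A_monomials q n e :: 'a mpoly set set) = (\<lambda>t. \<phi> (Poly_Mapping.single t 1)) ` {monomial_of n i | i. e dvd weight q n (monomial_of n i)}"
    unfolding A_monomials_def weight_monomial_of by (auto simp: cong_0_iff)
  also have "{monomial_of n i | i. e dvd weight q n (monomial_of n i)} = W"
    unfolding weight_monomials_def using monomial_of_in_monomials monomial_of_lookup
    by (auto, metis)
  finally show ?thesis .
qed

lemma subring_W: "subring (\<phi> ` supported W) Q"
proof (rule phi.ring.img_is_subring, rule P.subringI)
  show "supported W \<subseteq> carrier P"
    using supported_carrier W_subset by blast
  show "\<one>\<^bsub>P\<^esub> \<in> supported W"
    by (simp add: supported_def)
  show "\<ominus>\<^bsub>P\<^esub> p \<in> supported W" if "p \<in> supported W" for p
  proof -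
    have "\<ominus>\<^bsub>P\<^esub> p = - p"
      using supported_uminus[OF that] that supported_carrier[OF _ W_subset]
      by (intro P.minus_equality) auto
    then show ?thesis using supported_uminus[OF that] by simp
  qed
  show "p \<otimes>\<^bsub>P\<^esub> r \<in> supported W" if "p \<in> supported W" "r \<in> supported W" for p r
    using supported_mult[OF that weight_monomials_add] by simp
  show "p \<oplus>\<^bsub>P\<^esub> r \<in> supported W" if "p \<in> supported W" "r \<in> supported W" for p r
    using supported_add[OF that] by simp
qed

lemma const_mult_single: "mpoly_const c * Poly_Mapping.single t d = Poly_Mapping.single t (c * d)"
  by (simp add: mpoly_const_def Poly_Mapping.mult_single)

lemma const_carrier: "mpoly_const c \<in> carrier P"
  by (simp add: mpoly_const_def carrier_mpoly_ring supported_single)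

text \<open>\<open>W\<close> is closed under addition and contains 0, so its span is already a
  subring containing the constants. Conversely, each term is a constant times a generator.\<close>

lemma generated_subalgebra_eq:
  "generated_subalgebra Q (range (\<lambda>c. \<phi> (mpoly_const c))) (A_monomials q n e) = \<phi> ` supported W"
proof
  have "subalgebra (range (\<lambda>c. \<phi> (mpoly_const c))) (\<phi> ` supported W) Q"
  proof (intro subalgebra.intro subalgebra_axioms.intro)
    show "subgroup (\<phi> ` supported W) (add_monoid Q)"
      using subring_W by (rule subring.axioms)
    show "k \<otimes>\<^bsub>Q\<^esub> x \<in> \<phi> ` supported W"
      if k: "k \<in> range (\<lambda>c. \<phi> (mpoly_const c))" and x: "x \<in> \<phi> ` supported W" for k x
    proof -
      have "k \<in> \<phi> ` supported W"
        using k by (auto simp: mpoly_const_def supported_single)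
      then show ?thesis
        using subringE(6)[OF subring_W] x by blast
    qed
  qed
  moreover have "A_monomials q n e \<subseteq> \<phi> ` supported W"
    unfolding A_monomials_eq by (auto intro: supported_single)
  ultimately show "generated_subalgebra Q (range (\<lambda>c. \<phi> (mpoly_const c))) (A_monomials q n e)
      \<subseteq> \<phi> ` supported W"
    unfolding generated_subalgebra_def using subring_W by blast
next
  have "\<phi> p \<in> V" if "p \<in> supported W" and V: "subring V Q"
    "subalgebra (range (\<lambda>c. \<phi> (mpoly_const c))) V Q" "A_monomials q n e \<subseteq> V" for p V
    using that(1)
  proof (induction p rule: supported_induct)
    case zero
    then show ?case using subringE(2)[OF V(1)] phi_0 by simp
  next
    case (add p r)
    then show ?case
      using subringE(7)[OF V(1)] phi_hom(2) supported_carrier[OF _ W_subset] by metis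
  next
    case (single t c)
    then have "\<phi> (Poly_Mapping.single t 1) \<in> V"
      using V(3) unfolding A_monomials_eq by blast
    then have "\<phi> (mpoly_const c) \<otimes>\<^bsub>Q\<^esub> \<phi> (Poly_Mapping.single t 1) \<in> V"
      using subalgebra.smult_closed[OF V(2)] by blast
    moreover have "Poly_Mapping.single t (1::'a) \<in> carrier P"
      using supported_carrier[OF supported_single W_subset] single by blast
    ultimately show ?case
      using phi_hom(1)[OF const_carrier, of "Poly_Mapping.single t 1" c] by (simp add: const_mult_single)
  qed
  then show "\<phi> ` supported W
      \<subseteq> generated_subalgebra Q (range (\<lambda>c. \<phi> (mpoly_const c))) (A_monomials q n e)"
    unfolding generated_subalgebra_def by blast
qed

lemma A_eq: "A = Q\<lparr>carrier := \<phi> ` supported W\<rparr>"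
  by (simp add: A_algebra_def generated_subalgebra_eq)

lemma A_ops [simp]:
  "carrier A = \<phi> ` supported W" "x \<otimes>\<^bsub>A\<^esub> y = x \<otimes>\<^bsub>Q\<^esub> y" "x \<oplus>\<^bsub>A\<^esub> y = x \<oplus>\<^bsub>Q\<^esub> y"
  "\<one>\<^bsub>A\<^esub> = \<one>\<^bsub>Q\<^esub>" "\<zero>\<^bsub>A\<^esub> = \<zero>\<^bsub>Q\<^esub>"
  by (simp_all add: A_eq)

sublocale A: cring A
  unfolding A_eq using phi.S.subcring_iff phi.S.subcringI'[OF subring_W] subringE(1)[OF subring_W] by blast

section \<open>The augmentation ideal as the unique maximal ideal\<close>

abbreviation "N \<equiv> \<phi> ` supported (W - {0})"

lemma carrier_W: "p \<in> supported W \<Longrightarrow> p \<in> carrier P"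
  by (rule supported_carrier[OF _ W_subset])

lemma supported_W_minus_0: "p \<in> supported (W - {0}) \<Longrightarrow> p \<in> supported W"
  by (auto simp: supported_def)

lemma sum_zero_monomial_iff: "s + t = 0 \<longleftrightarrow> s = 0 \<and> t = (0 :: nat \<Rightarrow>\<^sub>0 nat)"
  by (auto simp: poly_mapping_eq_iff Poly_Mapping.lookup_add fun_eq_iff)

text \<open>Exponents cannot cancel, so a product with a nonconstant monomial stays
  nonconstant.\<close>

lemma ideal_N: "ideal N A"
proof (rule A.ideal_of_closed)
  show "N \<subseteq> carrier A"
    using supported_W_minus_0 by auto
  show "\<zero>\<^bsub>A\<^esub> \<in> N"
    using phi_0 by (auto intro!: image_eqI[of _ _ 0])
  fix x y assume "x \<in> N"
  then obtain p where p: "p \<in> supported (W - {0})" "x = \<phi> p" by blast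
  note p' = carrier_W[OF supported_W_minus_0[OF p(1)]]
  {
    assume "y \<in> N"
    then obtain r where r: "r \<in> supported (W - {0})" "y = \<phi> r" by blast
    note r' = carrier_W[OF supported_W_minus_0[OF r(1)]]
    show "x \<oplus>\<^bsub>A\<^esub> y \<in> N"
      using phi_hom(2)[OF p' r'] supported_add[OF p(1) r(1)] p(2) r(2) by auto
  next
    assume "y \<in> carrier A"
    then obtain r where r: "r \<in> supported W" "y = \<phi> r" by auto
    have "r * p \<in> supported (W - {0})"
      using r(1) p(1) by (rule supported_mult) (simp add: weight_monomials_add sum_zero_monomial_iff)
    then show "y \<otimes>\<^bsub>A\<^esub> x \<in> N"
      using phi_hom(1)[OF carrier_W[OF r(1)] p'] p(2) r(2) by auto
  }
qed

text \<open>Compare constant coefficients: a representative in \<open>W - {0}\<close> has none, and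
  the truncation ideal has none either because \<open>q\<close> is positive.\<close>

lemma one_notin_N: "\<one>\<^bsub>A\<^esub> \<notin> N"
proof
  assume "\<one>\<^bsub>A\<^esub> \<in> N"
  then obtain p where p: "p \<in> supported (W - {0})" "\<phi> p = \<phi> 1" using phi_1 by auto
  have c: "1 \<in> carrier P" "- p \<in> carrier P" "p \<in> carrier P"
    using P.one_closed carrier_W supported_uminus[OF p(1)] supported_W_minus_0 p(1) by auto
  have "\<phi> (1 + - p) = \<phi> p \<oplus>\<^bsub>Q\<^esub> \<phi> (- p)"
    using phi_hom(2)[OF c(1,2)] p(2) by simp
  also have "\<dots> = \<phi> (p + - p)"
    by (rule phi_hom(2)[symmetric, OF c(3,2)])
  finally have "1 + - p \<in> supported Z"
    using phi_eq_0_iff[of "1 + - p"] P.add.m_closed[OF c(1,2)] phi_0 by simp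
  moreover have "0 \<notin> Z"
    using q_gt_1 by (simp add: truncated_monomials_def)
  ultimately have "poly_mapping.lookup (1 + - p) 0 = 0"
    by (auto simp: supported_def in_keys_iff)
  moreover have "poly_mapping.lookup p 0 = 0"
    using p(1) by (auto simp: supported_def in_keys_iff)
  ultimately show False
    by (simp add: Poly_Mapping.lookup_minus)
qed

text \<open>An element outside \<open>N\<close> has a nonzero constant coefficient. Modulo
  \<open>N\<close> it equals this constant, which is invertible.\<close>

lemma maximalideal_N: "maximalideal N A"
proof (rule maximalidealI[OF ideal_N])
  show "carrier A \<noteq> N"
    using one_notin_N A.one_closed by blast
next
  fix J assume J: "ideal J A" "N \<subseteq> J" "J \<subseteq> carrier A"
  interpret J: ideal J A by (rule J(1))
  show "J = N \<or> J = carrier A"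
  proof (cases "J = N")
    case False
    then obtain x where x: "x \<in> J" "x \<notin> N" using J(2) by blast
    then obtain p where p: "p \<in> supported W" "x = \<phi> p" using J(3) by auto
    define c where "c = poly_mapping.lookup p 0"
    \<comment> \<open>Adding \<open>r\<close>, which has no constant term, strips \<open>p\<close>
      down to its constant part.\<close>
    define r where "r = mpoly_const c - p"
    have "Poly_Mapping.keys r \<subseteq> insert 0 (Poly_Mapping.keys p)"
      by (auto simp: r_def mpoly_const_def in_keys_iff Poly_Mapping.lookup_minus Poly_Mapping.lookup_single when_def split: if_splits)
    moreover have "poly_mapping.lookup r 0 = 0"
      by (simp add: r_def mpoly_const_def c_def Poly_Mapping.lookup_minus)
    ultimately have r: "r \<in> supported (W - {0})"
      using p(1) by (auto simp: supported_def in_keys_iff)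
    have c0: "c \<noteq> 0"
    proof
      assume "c = 0"
      then have "p \<in> supported (W - {0})"
        using p(1) by (auto simp: supported_def c_def in_keys_iff)
      then show False using x(2) p(2) by blast
    qed
    have "\<phi> (mpoly_const c) = \<phi> p \<oplus>\<^bsub>Q\<^esub> \<phi> r"
      using phi_hom(2)[OF carrier_W[OF p(1)] carrier_W[OF supported_W_minus_0[OF r]]]
      by (simp add: r_def)
    moreover have "\<phi> r \<in> J" using r J(2) by blast
    ultimately have "\<phi> (mpoly_const c) \<in> J"
      using J.a_closed[of x "\<phi> r"] x(1) p(2) by simp
    moreover have "\<phi> (mpoly_const (1 / c)) \<in> carrier A"
      by (auto simp: mpoly_const_def supported_single)
    ultimately have "\<phi> (mpoly_const (1 / c)) \<otimes>\<^bsub>A\<^esub> \<phi> (mpoly_const c) \<in> J"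
      by (rule J.I_l_closed)
    moreover have "mpoly_const (1 / c) * mpoly_const c = 1"
      using c0 by (simp add: mpoly_const_def Poly_Mapping.mult_single)
    ultimately have "\<one>\<^bsub>A\<^esub> \<in> J"
      using phi_hom(1)[OF const_carrier const_carrier, of "1 / c" c] phi_1 by simp
    then show ?thesis using J.one_imp_carrier by blast
  qed simp
qed

text \<open>The \<open>q\<close>-th power of a nonconstant term vanishes, since a positive exponent
  becomes at least \<open>q\<close>. Maximal ideals are prime and so contain all nilpotent
  elements.\<close>

lemma N_subset_maximalideal:
  assumes "maximalideal M A"
  shows "N \<subseteq> M"
proof
  interpret M: primeideal M A by (rule A.maximalideal_prime[OF assms])
  fix x assume "x \<in> N"
  then obtain p where p: "p \<in> supported (W - {0})" "x = \<phi> p" by blast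
  have "\<phi> p \<in> M"
    using p(1)
  proof (induction p rule: supported_induct)
    case zero
    then show ?case using M.zero_closed phi_0 by simp
  next
    case (add p r)
    then show ?case
      using phi_hom(2)[OF carrier_W carrier_W, OF supported_W_minus_0 supported_W_minus_0, of p r]
        M.a_closed[of "\<phi> p" "\<phi> r"] by simp
  next
    case (single t c)
    let ?x = "Poly_Mapping.single t c"
    have t: "t \<in> monomials n" using single W_subset by blast
    obtain j where j: "j \<in> {1..n}" "poly_mapping.lookup t j > 0"
      using monomials_nonzeroE[OF t] single by blast
    have xW: "?x \<in> supported W" using single by (simp add: supported_single)
    then have x: "?x \<in> carrier P" by (rule carrier_W)
    have "?x ^ q \<in> supported Z"
    proof (rule supported_mono[OF supported_power_single[OF t]])
      show "{s \<in> monomials n. \<forall>j. poly_mapping.lookup s j = q * poly_mapping.lookup t j} \<subseteq> Z"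
        using j by (auto simp: truncated_monomials_def intro!: bexI[of _ j])
    qed
    then have "\<phi> (?x ^ q) = \<zero>\<^bsub>Q\<^esub>"
      using phi_eq_0_iff supported_carrier by (auto simp: truncated_monomials_def)
    moreover have "\<phi> ?x [^]\<^bsub>Q\<^esub> q = \<phi> (?x ^ q)"
      using phi.ring.hom_nat_pow[OF x, of q] by simp
    moreover have "\<phi> ?x [^]\<^bsub>A\<^esub> q = \<phi> ?x [^]\<^bsub>Q\<^esub> q"
      by (simp add: nat_pow_def A_eq)
    ultimately have "\<phi> ?x [^]\<^bsub>A\<^esub> q \<in> M"
      using M.zero_closed by simp
    then show ?case
      using M.pow_mem_imp_mem[of "\<phi> ?x" q] xW by simp
  qed
  then show "x \<in> M" using p(2) by simp
qed

lemma jacobson_radical_A: "jacobson_radical A = N"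
proof
  show "jacobson_radical A \<subseteq> N"
    unfolding jacobson_radical_def using maximalideal_N by blast
  show "N \<subseteq> jacobson_radical A"
    unfolding jacobson_radical_def using N_subset_maximalideal supported_W_minus_0 by fastforce
qed

end

section \<open>Powers of the radical\<close>

context truncated_setup
begin

lemma ideals_power_0: "H [^]\<^bsub>ideals_set A\<^esub> (0::nat) = carrier A"
  by (simp add: nat_pow_def ideals_set_def)

lemma ideals_power_Suc: "H [^]\<^bsub>ideals_set A\<^esub> Suc l = ideal_prod A (H [^]\<^bsub>ideals_set A\<^esub> l) H"
  by (simp add: nat_pow_def ideals_set_def)

definition deg :: "(nat \<Rightarrow>\<^sub>0 nat) \<Rightarrow> nat" where
  "deg t = (\<Sum>j = 1..n. poly_mapping.lookup t j)"

lemma deg_add: "deg (s + t) = deg s + deg t"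
  by (simp add: deg_def Poly_Mapping.lookup_add sum.distrib)

text \<open>An admissible exponent vector is a vanishing sum of \<open>deg t\<close> powers of
  \<open>q\<close>.\<close>

lemma min_power_sum_le_deg:
  assumes "t \<in> W - {0}"
  shows "min_power_sum q e \<le> deg t"
proof -
  have "t \<in> monomials n" "t \<noteq> 0" using assms W_subset by auto
  then obtain j where "j \<in> {1..n}" "poly_mapping.lookup t j > 0"
    by (rule monomials_nonzeroE)
  then show ?thesis
    using assms min_power_sum_le_sum[of e q "poly_mapping.lookup t" n j]
    by (simp add: deg_def weight_monomials_def weight_def)
qed

definition high_degree :: "nat \<Rightarrow> (nat \<Rightarrow>\<^sub>0 nat) set" where
  "high_degree l = {t \<in> W. l * min_power_sum q e \<le> deg t}"

text \<open>Degrees add up, and each factor from \<open>N\<close> contributes at least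
  \<open>min_power_sum q e\<close>.\<close>

lemma N_power_subset: "N [^]\<^bsub>ideals_set A\<^esub> (l::nat) \<subseteq> \<phi> ` supported (high_degree l)"
proof (induction l)
  case 0
  show ?case unfolding ideals_power_0 by (simp add: high_degree_def)
next
  case (Suc l)
  have hW: "high_degree k \<subseteq> W" for k by (auto simp: high_degree_def)
  show ?case
  proof
    fix x assume "x \<in> N [^]\<^bsub>ideals_set A\<^esub> Suc l"
    then show "x \<in> \<phi> ` supported (high_degree (Suc l))"
      unfolding ideals_power_Suc
    proof (induction rule: ideal_prod.induct)
      case (prod i j)
      then obtain p r where p: "p \<in> supported (high_degree l)" "i = \<phi> p"
        and r: "r \<in> supported (W - {0})" "j = \<phi> r"
        using Suc by blast
      have "p * r \<in> supported (high_degree (Suc l))"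
        using p(1) r(1)
      proof (rule supported_mult)
        fix s t assume "s \<in> high_degree l" "t \<in> W - {0}"
        then show "s + t \<in> high_degree (Suc l)"
          using min_power_sum_le_deg[of t] by (auto simp: high_degree_def weight_monomials_add deg_add)
      qed
      moreover have "i \<otimes>\<^bsub>A\<^esub> j = \<phi> (p * r)"
        using phi_hom(1)[OF carrier_W[OF supported_mono[OF p(1) hW]] carrier_W[OF supported_W_minus_0[OF r(1)]]]
          p(2) r(2) by simp
      ultimately show ?case by blast
    next
      case (sum x y)
      then obtain p r where p: "p \<in> supported (high_degree (Suc l))" "x = \<phi> p"
        and r: "r \<in> supported (high_degree (Suc l))" "y = \<phi> r"
        by blast
      have "x \<oplus>\<^bsub>A\<^esub> y = \<phi> (p + r)"
        using phi_hom(2)[OF carrier_W[OF supported_mono[OF p(1) hW]] carrier_W[OF supported_mono[OF r(1) hW]]]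
          p(2) r(2) by simp
      then show ?case
        using supported_add[OF p(1) r(1)] by blast
    qed
  qed
qed

lemma zero_in_N_power: "\<zero>\<^bsub>A\<^esub> \<in> N [^]\<^bsub>ideals_set A\<^esub> (l::nat)"
proof (induction l)
  case 0
  show ?case unfolding ideals_power_0 by (rule A.zero_closed)
next
  case (Suc l)
  have "\<zero>\<^bsub>A\<^esub> \<in> N"
    by (rule additive_subgroup.zero_closed[OF ideal.axioms(1)[OF ideal_N]])
  from ideal_prod.prod[OF Suc this, of A] show ?case
    unfolding ideals_power_Suc by (simp only: A.l_null[OF A.zero_closed])
qed

text \<open>Pigeonhole: a degree above n (q - 1) forces some exponent to be at least
  \<open>q\<close>.\<close>

lemma N_power_eq_0:
  assumes "n * (q - 1) < l * min_power_sum q e"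
  shows "N [^]\<^bsub>ideals_set A\<^esub> l = {\<zero>\<^bsub>A\<^esub>}"
proof
  have "high_degree l \<subseteq> Z"
  proof
    fix t assume t: "t \<in> high_degree l"
    have "\<exists>j\<in>{1..n}. q \<le> poly_mapping.lookup t j"
    proof (rule ccontr)
      assume "\<not> ?thesis"
      then have "deg t \<le> (\<Sum>j = 1..n. q - 1)"
        unfolding deg_def by (intro sum_mono) force
      then show False
        using t assms by (simp add: high_degree_def)
    qed
    then show "t \<in> Z"
      using t W_subset by (auto simp: high_degree_def truncated_monomials_def)
  qed
  then have "\<phi> p = \<zero>\<^bsub>A\<^esub>" if "p \<in> supported (high_degree l)" for p
    using phi_eq_0_iff[of p] supported_mono[OF that, of Z] supported_carrier[of p Z]
    by (auto simp: truncated_monomials_def)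
  then show "N [^]\<^bsub>ideals_set A\<^esub> l \<subseteq> {\<zero>\<^bsub>A\<^esub>}"
    using N_power_subset[of l] by blast
  show "{\<zero>\<^bsub>A\<^esub>} \<subseteq> N [^]\<^bsub>ideals_set A\<^esub> l"
    using zero_in_N_power by blast
qed

text \<open>The product of the first \<open>l\<close> monomials of the packing lies in the power.
  Its exponents are bounded by those of the full packing, hence are below \<open>q\<close>, so it
  survives truncation.\<close>

lemma N_power_neq_0:
  assumes v: "packing q n e K v" and "l \<le> K"
  shows "N [^]\<^bsub>ideals_set A\<^esub> l \<noteq> {\<zero>\<^bsub>A\<^esub>}"
proof -
  define s where "s l = (\<Sum>k<l. monomial_of n (v k))" for l
  let ?x = "\<lambda>t. Poly_Mapping.single t (1::'a)"
  have s_mon: "s k \<in> monomials n" for k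
    by (induction k) (auto simp: s_def intro: monomials_add monomial_of_in_monomials)
  have carr: "?x t \<in> carrier P" if "t \<in> monomials n" for t
    unfolding carrier_mpoly_ring using that by (rule supported_single)
  have "\<phi> (?x (s l)) \<in> N [^]\<^bsub>ideals_set A\<^esub> l"
    using assms(2)
  proof (induction l)
    case 0
    then show ?case
      unfolding ideals_power_0 A_ops by (intro imageI supported_single) (simp add: s_def)
  next
    case (Suc l)
    let ?t = "monomial_of n (v l)"
    have "l < K" using Suc.prems by simp
    then have l: "e dvd (\<Sum>j = 1..n. q ^ (j - 1) * v l j)" "\<exists>j\<in>{1..n}. v l j > 0"
      using v unfolding packing_def by blast+
    then obtain j where "j \<in> {1..n}" "v l j > 0" by blast
    then have "poly_mapping.lookup ?t j \<noteq> 0"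
      by (simp add: lookup_monomial_of)
    then have "?t \<noteq> 0" by auto
    moreover have "?t \<in> W"
      using l(1) unfolding weight_monomials_def weight_monomial_of[symmetric]
      by (simp add: monomial_of_in_monomials)
    ultimately have "\<phi> (?x ?t) \<in> N"
      by (simp add: supported_single)
    with Suc have "\<phi> (?x (s l)) \<otimes>\<^bsub>A\<^esub> \<phi> (?x ?t) \<in> N [^]\<^bsub>ideals_set A\<^esub> Suc l"
      unfolding ideals_power_Suc by (intro ideal_prod.prod) auto
    moreover have "?x (s l) * ?x ?t = ?x (s (Suc l))"
      by (simp add: s_def Poly_Mapping.mult_single)
    ultimately show ?case
      using phi_hom(1)[OF carr[OF s_mon] carr[OF monomial_of_in_monomials], of l "v l"] by simp
  qed
  moreover have "s l \<notin> Z"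
  proof
    assume "s l \<in> Z"
    then obtain j where j: "j \<in> {1..n}" "q \<le> poly_mapping.lookup (s l) j"
      by (auto simp: truncated_monomials_def)
    then have "q \<le> (\<Sum>k<l. v k j)"
      by (simp add: s_def Poly_Mapping.lookup_sum lookup_monomial_of)
    also have "\<dots> \<le> (\<Sum>k<K. v k j)"
      using assms(2) by (intro sum_mono2) auto
    finally show False
      using v j(1) unfolding packing_def by fastforce
  qed
  then have "\<phi> (?x (s l)) \<noteq> \<zero>\<^bsub>A\<^esub>"
    using phi_eq_0_iff[OF carr[OF s_mon]] by (simp add: supported_def)
  ultimately show ?thesis by blast
qed

text \<open>The packing has the largest size that the degree bound allows, so the upper and lower
  bounds meet.\<close>

lemma loewy_length_A:
  assumes "packing q n e (n * (q - 1) div min_power_sum q e) v"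
  shows "loewy_length A = n * (q - 1) div min_power_sum q e + 1"
  unfolding loewy_length_def jacobson_radical_A
proof (rule Least_equality)
  let ?m = "min_power_sum q e"
  have "n * (q - 1) < (n * (q - 1) div ?m + 1) * ?m"
    using dividend_less_div_times[OF min_power_sum_pos[OF e_pos], of "n * (q - 1)" q] by simp
  then show "N [^]\<^bsub>ideals_set A\<^esub> (n * (q - 1) div ?m + 1) = {\<zero>\<^bsub>A\<^esub>}"
    by (rule N_power_eq_0)
next
  fix l :: nat assume "N [^]\<^bsub>ideals_set A\<^esub> l = {\<zero>\<^bsub>A\<^esub>}"
  then have "\<not> l \<le> n * (q - 1) div min_power_sum q e"
    using N_power_neq_0[OF assms] by blast
  then show "n * (q - 1) div min_power_sum q e + 1 \<le> l" by simp
qed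

end

theorem proposition5p3:
  fixes q n e :: nat
  assumes "n \<ge> 1" and "e \<ge> 1" and "q > 1"
    and "e dvd q ^ n - 1"
    and "\<exists>d \<in> {2, 3, 4 :: nat}. e dvd (q ^ d - 1) div (q - 1)"
  shows "int (loewy_length (A_algebra q n e :: ('a::field mpoly) set ring)) =
    \<lfloor>real n * ((real q - 1) / real (min_power_sum q e))\<rfloor> + 1"
proof -
  interpret truncated_setup q n e "TYPE('a)"
    by unfold_locales (use assms in auto)
  obtain v where "packing q n e (n * (q - 1) div min_power_sum q e) v"
    using ex_packing[OF assms(2,3,1,4,5)] by blast
  then have "loewy_length (A_algebra q n e :: 'a mpoly set ring) = n * (q - 1) div min_power_sum q e + 1"
    by (rule loewy_length_A)
  \<comment> \<open>Natural division is the floor of the real quotient; q > 1 makes the natural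
    subtraction agree with the real one.\<close>
  moreover have "real n * ((real q - 1) / real (min_power_sum q e))
      = real (n * (q - 1)) / real (min_power_sum q e)"
    using assms(3) by (simp add: of_nat_diff)
  ultimately show ?thesis
    by (simp only: floor_divide_of_nat_eq)
qed

end
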